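(* Let $\mathbb{F}$ be a field of characteristic different from $2$ and let $A$ be an infinite-dimensional unital locally matrix algebra over $\mathbb{F}$. Then the Lie algebra $A^{(-)}/\mathbb{F}\cdot 1$ is simple if and only if either $\operatorname{char}\mathbb{F}=0$, or $\operatorname{char}\mathbb{F}=p>0$ and $\nu_p(\mathbf{st}(A))\in\{0,\infty\}$.
   Context: An associative $\mathbb{F}$-algebra $A$ is called a locally matrix algebra if for every finite subset of $A$ there is a subalgebra $B\subset A$ containing this subset with $B\cong M_n(\mathbb{F})$ for some $n\in\mathbb{N}$ (positive integers). It is unital if it contains a unit $1$. For an associative algebra $A$, $A^{(-)}$ denotes the Lie algebra with underlying space $A$ and bracket $[a,b]=ab-ba$; $\mathbb{F}\cdot 1$ is a (central) ideal of it, so the quotient Lie algebra $A^{(-)}/\mathbb{F}\cdot 1$ is defined. Let $\mathbb{P}$ be the set of all primes. A Steinitz number is an infinite formal product $s=\prod_{p\in\mathbb{P}}p^{r_p}$ with $r_p\in\mathbb{N}\cup\{0,\infty\}$ for all $p\in\mathbb{P}$; put $\nu_p(s)=r_p$. Steinitz numbers are multiplied by adding exponents (with $t+\infty=\infty+t=\infty+\infty=\infty$), and divisibility and least common multiples are understood accordingly (exponentwise; the least common multiple is given by the exponentwise supremum). For a unital locally matrix algebra $A$, let $D(A)$ be the set of all $n\in\mathbb{N}$ such that there is a subalgebra $A'\subseteq A$ with $1\in A'$ and $A'\cong M_n(\mathbb{F})$. The Steinitz number $\mathbf{st}(A)$ of $A$ is the least common multiple of the set $D(A)$. *)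

theory Defs
  imports
    "HOL-Computational_Algebra.Computational_Algebra"
    "HOL-Library.Extended_Nat"
    "Jordan_Normal_Form.Matrix"
begin

section \<open>Steinitz numbers\<close>

text \<open>
  A Steinitz number is given by its exponents, indexed by the primes. A function on all natural
  numbers that vanishes off the primes encodes such a family uniquely.
\<close>

typedef steinitz = "{r :: nat \<Rightarrow> enat. \<forall>n. \<not> prime n \<longrightarrow> r n = 0}"
  by (rule exI[of _ "\<lambda>_. 0"]) simp

setup_lifting type_definition_steinitz

lift_definition nu :: "nat \<Rightarrow> steinitz \<Rightarrow> enat" is "\<lambda>p r. r p" .

lemma nu_nonprime [simp]: "\<not> prime p \<Longrightarrow> nu p s = 0"
  by transfer simp

lemma steinitz_eqI: "(\<And>p. prime p \<Longrightarrow> nu p s = nu p t) \<Longrightarrow> s = t"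
  by transfer (rule ext, metis mem_Collect_eq)

instantiation steinitz :: comm_monoid_mult
begin

lift_definition one_steinitz :: steinitz is "\<lambda>_. 0" by simp

lift_definition times_steinitz :: "steinitz \<Rightarrow> steinitz \<Rightarrow> steinitz" is "\<lambda>r s n. r n + s n" by simp

instance
  by standard (transfer; auto simp: ac_simps)+

end

lift_definition steinitz_of_nat :: "nat \<Rightarrow> steinitz"
  is "\<lambda>n p. if prime p then enat (multiplicity p n) else 0"
  by simp

lift_definition steinitz_lcm :: "steinitz set \<Rightarrow> steinitz"
  is "\<lambda>S p. SUP s\<in>S. nu p s"
proof -
  fix S :: "steinitz set" and p :: nat
  assume "\<not> prime p"
  then have "(SUP s\<in>S. nu p s) \<le> 0" by (intro SUP_least) simp
  then show "(SUP s\<in>S. nu p s) = 0" by simp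
qed

lemma nu_one [simp]: "nu p 1 = 0"
  by transfer simp

lemma nu_mult [simp]: "nu p (s * t) = nu p s + nu p t"
  by transfer simp

lemma nu_of_nat: "prime p \<Longrightarrow> nu p (steinitz_of_nat n) = enat (multiplicity p n)"
  by transfer simp

lemma nu_lcm: "nu p (steinitz_lcm S) = (SUP s\<in>S. nu p s)"
  by (simp add: nu.rep_eq steinitz_lcm.rep_eq)

lemma steinitz_dvd_iff: "s dvd t \<longleftrightarrow> (\<forall>p. prime p \<longrightarrow> nu p s \<le> nu p t)"
proof
  assume "s dvd t"
  then obtain u where "t = s * u" by (elim dvdE)
  then show "\<forall>p. prime p \<longrightarrow> nu p s \<le> nu p t" by simp
next
  assume le: "\<forall>p. prime p \<longrightarrow> nu p s \<le> nu p t"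
  define u where "u = Abs_steinitz (\<lambda>p. if prime p then nu p t - nu p s else 0)"
  have nu_u: "nu p u = nu p t - nu p s" if "prime p" for p
    using that unfolding u_def nu.rep_eq by (subst Abs_steinitz_inverse) auto
  have "t = s * u"
  proof (rule steinitz_eqI)
    fix p :: nat assume p: "prime p"
    with le have "nu p s \<le> nu p t" by blast
    then show "nu p t = nu p (s * u)"
      using nu_u[OF p] by (cases "nu p s"; cases "nu p t") auto
  qed
  then show "s dvd t" by simp
qed

lemma dvd_steinitz_lcm: "s \<in> S \<Longrightarrow> s dvd steinitz_lcm S"
  by (auto simp: steinitz_dvd_iff nu_lcm intro: SUP_upper)

lemma steinitz_lcm_least: "(\<And>s. s \<in> S \<Longrightarrow> s dvd t) \<Longrightarrow> steinitz_lcm S dvd t"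
  by (auto simp: steinitz_dvd_iff nu_lcm intro!: SUP_least)


section \<open>Locally matrix algebras\<close>

locale assoc_algebra = vector_space scale
  for scale :: "'f::field \<Rightarrow> 'a::ring \<Rightarrow> 'a" (infixr \<open>*s\<close> 75) +
  assumes scale_mult_left: "(c *s a) * b = c *s (a * b)"
    and scale_mult_right: "a * (c *s b) = c *s (a * b)"
begin

definition subalgebra :: "'a set \<Rightarrow> bool" where
  "subalgebra B \<longleftrightarrow> subspace B \<and> (\<forall>a\<in>B. \<forall>b\<in>B. a * b \<in> B)"

definition matrix_iso :: "nat \<Rightarrow> 'a set \<Rightarrow> ('f mat \<Rightarrow> 'a) \<Rightarrow> bool" where
  "matrix_iso n B \<phi> \<longleftrightarrow> bij_betw \<phi> (carrier_mat n n) B \<and>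
     (\<forall>M\<in>carrier_mat n n. \<forall>N\<in>carrier_mat n n.
        \<phi> (M + N) = \<phi> M + \<phi> N \<and> \<phi> (M * N) = \<phi> M * \<phi> N) \<and>
     (\<forall>c. \<forall>M\<in>carrier_mat n n. \<phi> (c \<cdot>\<^sub>m M) = c *s \<phi> M)"

definition matrix_subalgebra :: "nat \<Rightarrow> 'a set \<Rightarrow> bool" where
  "matrix_subalgebra n B \<longleftrightarrow> subalgebra B \<and> (\<exists>\<phi>. matrix_iso n B \<phi>)"

definition locally_matrix :: bool where
  "locally_matrix \<longleftrightarrow>
     (\<forall>X. finite X \<longrightarrow> (\<exists>n>0. \<exists>B. matrix_subalgebra n B \<and> X \<subseteq> B))"

definition infinite_dimensional :: bool where
  "infinite_dimensional \<longleftrightarrow> \<not> (\<exists>X. finite_dimensional_vector_space scale X)"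

end

locale unital_algebra = assoc_algebra scale
  for scale :: "'f::field \<Rightarrow> 'a::ring_1 \<Rightarrow> 'a" (infixr \<open>*s\<close> 75)
begin

definition matrix_degrees :: "nat set" where
  "matrix_degrees = {n. n > 0 \<and> (\<exists>B. matrix_subalgebra n B \<and> 1 \<in> B)}"

definition steinitz_number :: steinitz where
  "steinitz_number = steinitz_lcm (steinitz_of_nat ` matrix_degrees)"

end


section \<open>Lie algebras\<close>

record ('f, 'v) lie_struct = "'v partial_object" +
  lzero :: 'v
  ladd :: "'v \<Rightarrow> 'v \<Rightarrow> 'v"
  lscale :: "'f \<Rightarrow> 'v \<Rightarrow> 'v"
  lbracket :: "'v \<Rightarrow> 'v \<Rightarrow> 'v"

locale lie_algebra =
  fixes L :: "('f::field, 'v) lie_struct" (structure)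
  assumes zero_closed: "lzero L \<in> carrier L"
    and add_closed: "\<lbrakk>x \<in> carrier L; y \<in> carrier L\<rbrakk> \<Longrightarrow> ladd L x y \<in> carrier L"
    and scale_closed: "x \<in> carrier L \<Longrightarrow> lscale L c x \<in> carrier L"
    and bracket_closed: "\<lbrakk>x \<in> carrier L; y \<in> carrier L\<rbrakk> \<Longrightarrow> lbracket L x y \<in> carrier L"
    and add_assoc: "\<lbrakk>x \<in> carrier L; y \<in> carrier L; z \<in> carrier L\<rbrakk> \<Longrightarrow>
          ladd L (ladd L x y) z = ladd L x (ladd L y z)"
    and add_comm: "\<lbrakk>x \<in> carrier L; y \<in> carrier L\<rbrakk> \<Longrightarrow> ladd L x y = ladd L y x"
    and add_zero: "x \<in> carrier L \<Longrightarrow> ladd L (lzero L) x = x"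
    and add_inverse: "x \<in> carrier L \<Longrightarrow> \<exists>y\<in>carrier L. ladd L y x = lzero L"
    and scale_add: "\<lbrakk>x \<in> carrier L; y \<in> carrier L\<rbrakk> \<Longrightarrow>
          lscale L c (ladd L x y) = ladd L (lscale L c x) (lscale L c y)"
    and add_scale: "x \<in> carrier L \<Longrightarrow>
          lscale L (c + d) x = ladd L (lscale L c x) (lscale L d x)"
    and scale_scale: "x \<in> carrier L \<Longrightarrow> lscale L c (lscale L d x) = lscale L (c * d) x"
    and scale_one: "x \<in> carrier L \<Longrightarrow> lscale L 1 x = x"
    and bracket_add_left: "\<lbrakk>x \<in> carrier L; y \<in> carrier L; z \<in> carrier L\<rbrakk> \<Longrightarrow>
          lbracket L (ladd L x y) z = ladd L (lbracket L x z) (lbracket L y z)"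
    and bracket_add_right: "\<lbrakk>x \<in> carrier L; y \<in> carrier L; z \<in> carrier L\<rbrakk> \<Longrightarrow>
          lbracket L x (ladd L y z) = ladd L (lbracket L x y) (lbracket L x z)"
    and bracket_scale_left: "\<lbrakk>x \<in> carrier L; y \<in> carrier L\<rbrakk> \<Longrightarrow>
          lbracket L (lscale L c x) y = lscale L c (lbracket L x y)"
    and bracket_scale_right: "\<lbrakk>x \<in> carrier L; y \<in> carrier L\<rbrakk> \<Longrightarrow>
          lbracket L x (lscale L c y) = lscale L c (lbracket L x y)"
    and bracket_self: "x \<in> carrier L \<Longrightarrow> lbracket L x x = lzero L"
    and jacobi: "\<lbrakk>x \<in> carrier L; y \<in> carrier L; z \<in> carrier L\<rbrakk> \<Longrightarrow>
          ladd L (lbracket L x (lbracket L y z))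
            (ladd L (lbracket L y (lbracket L z x)) (lbracket L z (lbracket L x y))) = lzero L"

definition lie_ideal :: "('f::field, 'v) lie_struct \<Rightarrow> 'v set \<Rightarrow> bool" where
  "lie_ideal L I \<longleftrightarrow> I \<subseteq> carrier L \<and> lzero L \<in> I \<and>
     (\<forall>x\<in>I. \<forall>y\<in>I. ladd L x y \<in> I) \<and>
     (\<forall>c. \<forall>x\<in>I. lscale L c x \<in> I) \<and>
     (\<forall>x\<in>carrier L. \<forall>y\<in>I. lbracket L x y \<in> I)"

definition simple_lie_algebra :: "('f::field, 'v) lie_struct \<Rightarrow> bool" where
  "simple_lie_algebra L \<longleftrightarrow> lie_algebra L \<and>
     (\<exists>x\<in>carrier L. \<exists>y\<in>carrier L. lbracket L x y \<noteq> lzero L) \<and>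
     (\<forall>I. lie_ideal L I \<longrightarrow> I = {lzero L} \<or> I = carrier L)"

definition lie_coset :: "('f::field, 'v) lie_struct \<Rightarrow> 'v set \<Rightarrow> 'v \<Rightarrow> 'v set" where
  "lie_coset L I x = (\<lambda>i. ladd L x i) ` I"

text \<open>
  The operations on cosets are the unions of the cosets obtained from all choices of
  representatives; when \<open>I\<close> is an ideal these unions consist of a single coset, see
  \<open>lie_coset_add\<close>, \<open>lie_coset_scale\<close> and \<open>lie_coset_bracket\<close> below.
\<close>

definition lie_quotient ::
    "('f::field, 'v) lie_struct \<Rightarrow> 'v set \<Rightarrow> ('f, 'v set) lie_struct" where
  "lie_quotient L I = \<lparr>
     carrier = lie_coset L I ` carrier L,
     lzero = I,
     ladd = (\<lambda>X Y. \<Union>x\<in>X. \<Union>y\<in>Y. lie_coset L I (ladd L x y)),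
     lscale = (\<lambda>c X. \<Union>x\<in>X. lie_coset L I (lscale L c x)),
     lbracket = (\<lambda>X Y. \<Union>x\<in>X. \<Union>y\<in>Y. lie_coset L I (lbracket L x y))\<rparr>"

locale lie_algebra_ideal = lie_algebra L
  for L :: "('f::field, 'v) lie_struct" (structure) +
  fixes I :: "'v set"
  assumes ideal: "lie_ideal L I"
begin

lemma ideal_sub: "i \<in> I \<Longrightarrow> i \<in> carrier L"
  and ideal_zero: "lzero L \<in> I"
  and ideal_add: "\<lbrakk>i \<in> I; j \<in> I\<rbrakk> \<Longrightarrow> ladd L i j \<in> I"
  and ideal_scale: "i \<in> I \<Longrightarrow> lscale L c i \<in> I"
  and ideal_bracket_right: "\<lbrakk>x \<in> carrier L; i \<in> I\<rbrakk> \<Longrightarrow> lbracket L x i \<in> I"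
  using ideal unfolding lie_ideal_def by auto

lemma add_left_cancel:
  assumes "x \<in> carrier L" "y \<in> carrier L" "z \<in> carrier L" "ladd L x y = ladd L x z"
  shows "y = z"
proof -
  obtain w where w: "w \<in> carrier L" "ladd L w x = lzero L" using add_inverse assms(1) by blast
  have "ladd L (ladd L w x) y = ladd L (ladd L w x) z"
    using add_assoc[OF w(1) assms(1,2)] add_assoc[OF w(1) assms(1,3)] assms(4) by simp
  then show ?thesis using w(2) add_zero assms(2,3) by metis
qed

lemma scale_zero_left: "x \<in> carrier L \<Longrightarrow> lscale L 0 x = lzero L"
proof -
  assume x: "x \<in> carrier L"
  have "ladd L (lscale L 0 x) (lscale L 0 x) = ladd L (lscale L 0 x) (lzero L)"
    using add_scale[OF x, of 0 0] add_zero[of "lscale L 0 x"] add_comm[of "lscale L 0 x" "lzero L"]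
      scale_closed[OF x] zero_closed by simp
  then show ?thesis
    using add_left_cancel scale_closed[OF x] zero_closed by blast
qed

lemma add_neg: "x \<in> carrier L \<Longrightarrow> ladd L x (lscale L (-1) x) = lzero L"
  using add_scale[of x 1 "-1"] scale_one scale_zero_left by simp

lemma bracket_swap:
  assumes x: "x \<in> carrier L" and y: "y \<in> carrier L"
  shows "lbracket L x y = lscale L (-1) (lbracket L y x)"
proof -
  let ?b = "lbracket L"
  have c: "?b x y \<in> carrier L" "?b y x \<in> carrier L" using x y bracket_closed by auto
  have "lzero L = ?b (ladd L x y) (ladd L x y)"
    using bracket_self add_closed x y by simp
  also have "\<dots> = ladd L (ladd L (?b x x) (?b y x)) (ladd L (?b x y) (?b y y))"
    using x y by (simp add: bracket_add_left bracket_add_right add_closed)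
  also have "\<dots> = ladd L (?b y x) (?b x y)"
    using x y c by (simp add: bracket_self add_zero add_comm[of _ "lzero L"] zero_closed)
  finally have "ladd L (?b y x) (?b x y) = ladd L (?b y x) (lscale L (-1) (?b y x))"
    using add_neg[OF c(2)] by simp
  then show ?thesis using add_left_cancel c scale_closed by blast
qed

lemma ideal_bracket_left: "\<lbrakk>x \<in> carrier L; i \<in> I\<rbrakk> \<Longrightarrow> lbracket L i x \<in> I"
  using bracket_swap[of i x] ideal_bracket_right ideal_scale ideal_sub by simp

lemma coset_absorb:
  assumes x: "x \<in> carrier L" and i: "i \<in> I"
  shows "lie_coset L I (ladd L x i) = lie_coset L I x"
proof -
  have "ladd L (ladd L x i) j \<in> lie_coset L I x" if j: "j \<in> I" for j
    using x i j ideal_sub unfolding lie_coset_def by (auto simp: add_assoc intro: ideal_add)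
  moreover have "ladd L x j \<in> lie_coset L I (ladd L x i)" if j: "j \<in> I" for j
  proof -
    have n: "lscale L (-1) i \<in> I" using i ideal_scale by blast
    have "ladd L (ladd L x i) (ladd L (lscale L (-1) i) j)
          = ladd L x (ladd L (ladd L i (lscale L (-1) i)) j)"
      using x i j n ideal_sub by (simp add: add_assoc add_closed)
    also have "\<dots> = ladd L x j"
      using i j ideal_sub by (simp add: add_neg add_zero)
    finally show ?thesis
      unfolding lie_coset_def using ideal_add[OF n j] by (metis image_eqI)
  qed
  ultimately show ?thesis unfolding lie_coset_def by blast
qed

lemma coset_rep: "x \<in> carrier L \<Longrightarrow> x \<in> lie_coset L I x"
  unfolding lie_coset_def using ideal_zero add_zero add_comm zero_closed by (metis image_eqI)

lemma coset_zero: "lie_coset L I (lzero L) = I"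
  unfolding lie_coset_def using ideal_sub add_zero by simp

lemma lie_coset_add:
  assumes x: "x \<in> carrier L" and y: "y \<in> carrier L"
  shows "ladd (lie_quotient L I) (lie_coset L I x) (lie_coset L I y) = lie_coset L I (ladd L x y)"
proof -
  have "lie_coset L I (ladd L x' y') = lie_coset L I (ladd L x y)"
    if "x' \<in> lie_coset L I x" "y' \<in> lie_coset L I y" for x' y'
  proof -
    from that obtain i j where ij: "i \<in> I" "j \<in> I" "x' = ladd L x i" "y' = ladd L y j"
      unfolding lie_coset_def by auto
    have ic: "i \<in> carrier L" and jc: "j \<in> carrier L" using ij ideal_sub by auto
    have "ladd L x' y' = ladd L x (ladd L (ladd L i y) j)"
      unfolding ij using x y ic jc by (simp add: add_assoc add_closed)
    also have "\<dots> = ladd L (ladd L x y) (ladd L i j)"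
      unfolding add_comm[OF ic y] using x y ic jc by (simp add: add_assoc add_closed)
    finally show ?thesis using coset_absorb add_closed[OF x y] ideal_add ij by simp
  qed
  then have "(\<Union>x'\<in>lie_coset L I x. \<Union>y'\<in>lie_coset L I y. lie_coset L I (ladd L x' y'))
      = (\<Union>x'\<in>lie_coset L I x. \<Union>y'\<in>lie_coset L I y. lie_coset L I (ladd L x y))"
    by (intro SUP_cong refl)
  also have "\<dots> = lie_coset L I (ladd L x y)"
    using coset_rep[OF x] coset_rep[OF y] by blast
  finally show ?thesis unfolding lie_quotient_def by simp
qed

lemma lie_coset_scale:
  assumes x: "x \<in> carrier L"
  shows "lscale (lie_quotient L I) c (lie_coset L I x) = lie_coset L I (lscale L c x)"
proof -
  have "lie_coset L I (lscale L c x') = lie_coset L I (lscale L c x)"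
    if "x' \<in> lie_coset L I x" for x'
  proof -
    from that obtain i where i: "i \<in> I" "x' = ladd L x i"
      unfolding lie_coset_def by auto
    then show ?thesis
      using x coset_absorb scale_closed ideal_scale ideal_sub by (simp add: scale_add)
  qed
  then have "(\<Union>x'\<in>lie_coset L I x. lie_coset L I (lscale L c x'))
      = (\<Union>x'\<in>lie_coset L I x. lie_coset L I (lscale L c x))"
    by (intro SUP_cong refl)
  also have "\<dots> = lie_coset L I (lscale L c x)"
    using coset_rep[OF x] by blast
  finally show ?thesis unfolding lie_quotient_def by simp
qed

lemma lie_coset_bracket:
  assumes x: "x \<in> carrier L" and y: "y \<in> carrier L"
  shows "lbracket (lie_quotient L I) (lie_coset L I x) (lie_coset L I y)
       = lie_coset L I (lbracket L x y)"
proof -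
  have "lie_coset L I (lbracket L x' y') = lie_coset L I (lbracket L x y)"
    if "x' \<in> lie_coset L I x" "y' \<in> lie_coset L I y" for x' y'
  proof -
    from that obtain i j where ij: "i \<in> I" "j \<in> I" "x' = ladd L x i" "y' = ladd L y j"
      unfolding lie_coset_def by auto
    have ic: "i \<in> carrier L" and jc: "j \<in> carrier L" using ij ideal_sub by auto
    have b: "lbracket L x j \<in> I" "lbracket L i y \<in> I" "lbracket L i j \<in> I"
      using ideal_bracket_left ideal_bracket_right x y ij ic by auto
    have "lbracket L x' y' = ladd L (ladd L (lbracket L x y) (lbracket L i y))
        (ladd L (lbracket L x j) (lbracket L i j))"
      unfolding ij using x y ic jc by (simp add: bracket_add_left bracket_add_right add_closed)
    also have "\<dots> = ladd L (lbracket L x y)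
        (ladd L (lbracket L i y) (ladd L (lbracket L x j) (lbracket L i j)))"
      using x y ic jc by (simp add: add_assoc add_closed bracket_closed)
    finally show ?thesis using coset_absorb bracket_closed[OF x y] ideal_add b by simp
  qed
  then have "(\<Union>x'\<in>lie_coset L I x. \<Union>y'\<in>lie_coset L I y. lie_coset L I (lbracket L x' y'))
      = (\<Union>x'\<in>lie_coset L I x. \<Union>y'\<in>lie_coset L I y. lie_coset L I (lbracket L x y))"
    by (intro SUP_cong refl)
  also have "\<dots> = lie_coset L I (lbracket L x y)"
    using coset_rep[OF x] coset_rep[OF y] by blast
  finally show ?thesis unfolding lie_quotient_def by simp
qed

theorem lie_algebra_quotient: "lie_algebra (lie_quotient L I)"
proof -
  have car: "carrier (lie_quotient L I) = lie_coset L I ` carrier L"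
    and zer: "lzero (lie_quotient L I) = lie_coset L I (lzero L)"
    unfolding lie_quotient_def coset_zero by simp_all
  note ops = lie_coset_add lie_coset_scale lie_coset_bracket
    add_closed scale_closed bracket_closed zero_closed
  show ?thesis
  proof (unfold_locales, unfold car zer, goal_cases)
    case (8 x)
    then obtain x' where x': "x' \<in> carrier L" "x = lie_coset L I x'" by blast
    then obtain y' where "y' \<in> carrier L" "ladd L y' x' = lzero L" using add_inverse by blast
    with x' show ?case by (auto simp: ops intro!: bexI[of _ y'])
  next
    case 6 then show ?case by (auto simp: ops add_comm)
  qed (auto simp: ops add_assoc add_zero scale_add add_scale scale_scale scale_one
        bracket_add_left bracket_add_right bracket_scale_left bracket_scale_right
        bracket_self jacobi)
qed

end

context assoc_algebra
begin

definition lie_of_algebra :: "('f, 'a) lie_struct" where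
  "lie_of_algebra = \<lparr>carrier = UNIV, lzero = 0, ladd = (+), lscale = (*s),
     lbracket = (\<lambda>a b. a * b - b * a)\<rparr>"

lemma lie_algebra_lie_of_algebra: "lie_algebra lie_of_algebra"
proof (unfold_locales, unfold lie_of_algebra_def, goal_cases)
  case (8 x)
  then show ?case by (auto intro: exI[of _ "- x"])
qed (simp_all add: algebra_simps scale_mult_left scale_mult_right)

end

context unital_algebra
begin

definition scalars :: "'a set" where
  "scalars = range (\<lambda>c. c *s 1)"

lemma lie_ideal_scalars: "lie_ideal lie_of_algebra scalars"
proof -
  have "\<exists>d. c *s 1 + c' *s 1 = d *s (1::'a)" for c c'
    by (metis scale_left_distrib)
  moreover have "\<exists>d. 0 = d *s (1::'a)"
    by (metis scale_zero_left)
  moreover have "x * (c *s 1) - (c *s 1) * x = 0" for x :: 'a and c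
    by (simp add: scale_mult_left scale_mult_right)
  ultimately show ?thesis
    unfolding lie_ideal_def lie_of_algebra_def scalars_def by (auto simp: image_iff)
qed

lemma lie_algebra_mod_scalars: "lie_algebra (lie_quotient lie_of_algebra scalars)"
proof -
  interpret lie_algebra lie_of_algebra by (rule lie_algebra_lie_of_algebra)
  interpret lie_algebra_ideal lie_of_algebra scalars
    by unfold_locales (rule lie_ideal_scalars)
  show ?thesis by (rule lie_algebra_quotient)
qed

end

end

theory Submission
  imports Defs
begin

text \<open>
  Write \<open>[A, A]\<close> for the span of the commutators of \<open>A\<close>, and \<open>F1\<close> for the scalars. Every finite
  subset of \<open>A\<close> lies in a matrix subalgebra that contains \<open>1\<close>, so that computations with matrix units
  decide the question, in two steps.

  \<^item> A Lie ideal of \<open>A\<close> that contains an element \<open>a\<close> which is not a scalar contains \<open>[A, A]\<close>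
    (\<open>commutators_in_nonscalar_lie_ideal\<close>). The identity \<open>[e, [e, a]] = - 2 * e * a * e\<close> for \<open>e * e = 0\<close>
    isolates entries of \<open>a\<close> and puts an off-diagonal matrix unit into the ideal; brackets with other
    units do the rest. Since \<open>[A, A] + F1\<close> is itself a Lie ideal, and
    is larger than \<open>F1\<close> because \<open>A\<close> has infinite dimension, the quotient of \<open>A\<close> by the scalars is
    simple if and only if \<open>A = [A, A] + F1\<close>.

  \<^item> A matrix subalgebra with units \<open>E i j\<close> of degree \<open>n\<close> is spanned modulo commutators by \<open>E 0 0\<close>, and
    \<open>1\<close> is congruent to \<open>n * E 0 0\<close>. This settles the case in which \<open>n\<close> is invertible in the field
    (\<open>corner_unit_if_degree_invertible\<close>). In general the class of \<open>E 0 0\<close> is compared with that of the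
    corner unit \<open>f 0 0\<close> of a larger matrix algebra, of degree \<open>k\<close>. There \<open>k = n * d\<close>, and \<open>E 0 0\<close> is an
    idempotent of rank \<open>d\<close>, hence a sum of \<open>d\<close> products \<open>u * v\<close> with \<open>v * u = f 0 0\<close>
    (\<open>unit_splits_into_equivalent_units\<close>); so \<open>E 0 0\<close> is congruent to \<open>d * f 0 0\<close>.

  In characteristic zero every degree is invertible. Let the characteristic be \<open>p > 0\<close>. If the exponent of \<open>p\<close> in the Steinitz number is \<open>0\<close>, every degree
  is again invertible. If it is infinite, \<open>k\<close> can be chosen with \<open>p\<close> dividing \<open>d\<close>, and \<open>E 0 0\<close> is in \<open>[A, A]\<close>
  (\<open>corner_unit_if_prime_power_divides_degrees\<close>). If it is finite and positive, take \<open>n\<close> to contain the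
  largest power of \<open>p\<close>. Then \<open>p\<close> divides \<open>n\<close>, and never divides \<open>d\<close>. In a large enough matrix algebra the
  trace kills the commutators and \<open>1\<close>, but sends \<open>E 0 0\<close> to \<open>d \<noteq> 0\<close>; so \<open>E 0 0\<close> is not in
  \<open>[A, A] + F1\<close> (\<open>corner_unit_not_in_scalar_commutator_span\<close>).
\<close>

section \<open>Simplicity of a quotient Lie algebra\<close>

context lie_algebra_ideal
begin

lemma coset_eq_ideal_iff: "x \<in> carrier L \<Longrightarrow> lie_coset L I x = I \<longleftrightarrow> x \<in> I"
  using coset_rep coset_absorb[OF zero_closed, of x] coset_zero add_zero by auto

lemma carrier_quotient: "carrier (lie_quotient L I) = lie_coset L I ` carrier L"
  and zero_quotient: "lzero (lie_quotient L I) = I"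
  by (simp_all add: lie_quotient_def)

lemma preimage_lie_ideal:
  assumes J: "lie_ideal (lie_quotient L I) J"
  shows "lie_ideal L {x \<in> carrier L. lie_coset L I x \<in> J}" 
    and "I \<subseteq> {x \<in> carrier L. lie_coset L I x \<in> J}"
proof -
  let ?K = "{x \<in> carrier L. lie_coset L I x \<in> J}"
  have J': "J \<subseteq> lie_coset L I ` carrier L" "I \<in> J"
    "\<And>x y. \<lbrakk>x \<in> J; y \<in> J\<rbrakk> \<Longrightarrow> ladd (lie_quotient L I) x y \<in> J"
    "\<And>c x. x \<in> J \<Longrightarrow> lscale (lie_quotient L I) c x \<in> J"
    "\<And>x y. \<lbrakk>x \<in> carrier (lie_quotient L I); y \<in> J\<rbrakk> \<Longrightarrow> lbracket (lie_quotient L I) x y \<in> J"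
    using J unfolding lie_ideal_def zero_quotient carrier_quotient by auto
  have [simp]: "lie_coset L I i = I" if "i \<in> I" for i
    using that ideal_sub coset_eq_ideal_iff by blast
  show "I \<subseteq> ?K" using ideal_sub J'(2) by auto
  show "lie_ideal L ?K"
    unfolding lie_ideal_def
  proof (intro conjI ballI allI)
    show "lzero L \<in> ?K" using zero_closed ideal_zero J'(2) by simp
    fix x y assume "x \<in> ?K" "y \<in> ?K"
    then show "ladd L x y \<in> ?K" using J'(3) add_closed by (auto simp flip: lie_coset_add)
  next
    fix c x assume "x \<in> ?K"
    then show "lscale L c x \<in> ?K" using J'(4) scale_closed by (auto simp flip: lie_coset_scale)
  next
    fix x y assume "x \<in> carrier L" "y \<in> ?K"
    then show "lbracket L x y \<in> ?K"
      using J'(5) bracket_closed by (auto simp: carrier_quotient simp flip: lie_coset_bracket)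
  qed auto
qed

lemma image_lie_ideal:
  assumes K: "lie_ideal L K"
  shows "lie_ideal (lie_quotient L I) (lie_coset L I ` K)"
proof -
  have K': "K \<subseteq> carrier L" "lzero L \<in> K" "\<And>x. x \<in> K \<Longrightarrow> x \<in> carrier L"
    "\<And>x y. \<lbrakk>x \<in> K; y \<in> K\<rbrakk> \<Longrightarrow> ladd L x y \<in> K" "\<And>c x. x \<in> K \<Longrightarrow> lscale L c x \<in> K"
    "\<And>x y. \<lbrakk>x \<in> carrier L; y \<in> K\<rbrakk> \<Longrightarrow> lbracket L x y \<in> K"
    using K unfolding lie_ideal_def by auto
  show ?thesis
    unfolding lie_ideal_def carrier_quotient zero_quotient
    using K' coset_zero by (auto simp: lie_coset_add lie_coset_scale lie_coset_bracket image_iff)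
qed

text \<open>
Taking preimages and images of cosets matches the ideals of the quotient with the ideals of \<open>L\<close> that
contain \<open>I\<close>.
\<close>

lemma simple_quotient_iff:
  "simple_lie_algebra (lie_quotient L I) \<longleftrightarrow>
     (\<exists>x\<in>carrier L. \<exists>y\<in>carrier L. lbracket L x y \<notin> I) \<and>
     (\<forall>K. lie_ideal L K \<and> I \<subseteq> K \<longrightarrow> K = I \<or> K = carrier L)"
proof -
  have brackets: "(\<exists>x\<in>carrier (lie_quotient L I). \<exists>y\<in>carrier (lie_quotient L I).
            lbracket (lie_quotient L I) x y \<noteq> lzero (lie_quotient L I)) \<longleftrightarrow>
        (\<exists>x\<in>carrier L. \<exists>y\<in>carrier L. lbracket L x y \<notin> I)"
  proof -
    have "lbracket (lie_quotient L I) (lie_coset L I x) (lie_coset L I y) = I \<longleftrightarrow> lbracket L x y \<in> I"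
      if "x \<in> carrier L" "y \<in> carrier L" for x y
      using that by (simp only: lie_coset_bracket coset_eq_ideal_iff bracket_closed)
    then show ?thesis unfolding carrier_quotient zero_quotient by blast
  qed
  have down: "K = I \<or> K = carrier L"
    if all: "\<And>J. lie_ideal (lie_quotient L I) J \<Longrightarrow> J = {I} \<or> J = lie_coset L I ` carrier L"
      and K: "lie_ideal L K" "I \<subseteq> K" for K
  proof -
    have K': "\<And>x. x \<in> K \<Longrightarrow> x \<in> carrier L" "\<And>x y. \<lbrakk>x \<in> K; y \<in> K\<rbrakk> \<Longrightarrow> ladd L x y \<in> K"
      using K unfolding lie_ideal_def by auto
    consider "lie_coset L I ` K = {I}" | "lie_coset L I ` K = lie_coset L I ` carrier L"
      using all[OF image_lie_ideal[OF K(1)]] by blast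
    then show ?thesis
    proof cases
      case 1
      then have "lie_coset L I x = I" if "x \<in> K" for x using that by blast
      then have "K \<subseteq> I" using K'(1) coset_eq_ideal_iff by (metis subsetI)
      with K show ?thesis by blast
    next
      case 2
      have "x \<in> K" if x: "x \<in> carrier L" for x
      proof -
        obtain k where k: "k \<in> K" "lie_coset L I x = lie_coset L I k" using 2 x by blast
        then obtain i where "i \<in> I" "x = ladd L k i"
          using coset_rep[OF x] unfolding lie_coset_def by auto
        then show ?thesis using k K' K(2) by auto
      qed
      with K' show ?thesis by blast
    qed
  qed
  have up: "J = {I} \<or> J = lie_coset L I ` carrier L"
    if all: "\<And>K. \<lbrakk>lie_ideal L K; I \<subseteq> K\<rbrakk> \<Longrightarrow> K = I \<or> K = carrier L"
      and J: "lie_ideal (lie_quotient L I) J" for J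
  proof -
    have J': "J \<subseteq> lie_coset L I ` carrier L" "I \<in> J"
      using J unfolding lie_ideal_def zero_quotient carrier_quotient by auto
    let ?K = "{x \<in> carrier L. lie_coset L I x \<in> J}"
    have JK: "J = lie_coset L I ` ?K" using J'(1) by blast
    consider "?K = I" | "?K = carrier L"
      using all[OF preimage_lie_ideal[OF J]] by blast
    then show ?thesis
    proof cases
      case 1
      then have "J = lie_coset L I ` I" using JK by simp
      moreover have "lie_coset L I i = I" if "i \<in> I" for i
        using that ideal_sub coset_eq_ideal_iff by metis
      ultimately have "J \<subseteq> {I}" by blast
      then show ?thesis using J'(2) by blast
    next
      case 2
      then show ?thesis using JK by simp
    qed
  qed
  have ideals: "(\<forall>J. lie_ideal (lie_quotient L I) J \<longrightarrow>
        J = {lzero (lie_quotient L I)} \<or> J = carrier (lie_quotient L I)) \<longleftrightarrow>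
      (\<forall>K. lie_ideal L K \<and> I \<subseteq> K \<longrightarrow> K = I \<or> K = carrier L)"
    unfolding carrier_quotient zero_quotient
  proof (intro iffI allI impI, elim conjE)
    fix K assume "\<forall>J. lie_ideal (lie_quotient L I) J \<longrightarrow> J = {I} \<or> J = lie_coset L I ` carrier L"
      "lie_ideal L K" "I \<subseteq> K"
    then show "K = I \<or> K = carrier L" by (intro down) simp_all
  next
    fix J assume "\<forall>K. lie_ideal L K \<and> I \<subseteq> K \<longrightarrow> K = I \<or> K = carrier L"
      "lie_ideal (lie_quotient L I) J"
    then show "J = {I} \<or> J = lie_coset L I ` carrier L" by (intro up) simp_all
  qed
  show ?thesis
    unfolding simple_lie_algebra_def brackets ideals using lie_algebra_quotient by simp
qed

end

section \<open>Systems of matrix units\<close>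

text \<open>
The proof never looks at matrices: a unital subalgebra isomorphic to the \<open>n \<times> n\<close> matrices is
represented by a system of \<open>n\<^sup>2\<close> matrix units whose diagonal members add up to \<open>1\<close>. Different systems
live in the same algebra, so an inclusion of matrix subalgebras is just a membership statement.
\<close>

locale matrix_units = unital_algebra scale
  for scale :: "'f::field \<Rightarrow> 'a::ring_1 \<Rightarrow> 'a" (infixr \<open>*s\<close> 75) +
  fixes n :: nat and e :: "nat \<Rightarrow> nat \<Rightarrow> 'a"
  assumes unit_mult: "\<lbrakk>i < n; j < n; k < n; l < n\<rbrakk> \<Longrightarrow> e i j * e k l = (if j = k then e i l else 0)"
    and unit_sum: "(\<Sum>i<n. e i i) = 1"
begin

definition unit_span :: "'a set" where
  "unit_span = span {e i j |i j. i < n \<and> j < n}"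

lemma size_pos: "0 < n"
  using unit_sum by (cases n) auto

lemma unit_mult_assoc:
  "\<lbrakk>i < n; j < n; k < n; l < n\<rbrakk> \<Longrightarrow> e i j * (e k l * x) = (if j = k then e i l * x else 0)"
  using unit_mult[of i j k l] by (simp flip: mult.assoc)

lemma unit_nonzero: assumes "i < n" "j < n" shows "e i j \<noteq> 0"
proof
  assume 0: "e i j = 0"
  have "e l l = e l i * e i j * e j l" if "l < n" for l
    using that assms by (simp add: unit_mult)
  then have "(\<Sum>l<n. e l l) = 0" unfolding 0 by simp
  then show False using unit_sum by simp
qed

lemma unit_in_unit_span: "\<lbrakk>i < n; j < n\<rbrakk> \<Longrightarrow> e i j \<in> unit_span"
  unfolding unit_span_def by (intro span_base) auto

lemma unit_span_induct [consumes 1, case_names subspace unit]: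
  assumes "x \<in> unit_span" "subspace {x. P x}" "\<And>i j. \<lbrakk>i < n; j < n\<rbrakk> \<Longrightarrow> P (e i j)"
  shows "P x"
  using assms(1) unfolding unit_span_def
  by (rule span_induct) (use assms(2,3) in auto)

lemma unit_span_mult: assumes x: "x \<in> unit_span" and y: "y \<in> unit_span" shows "x * y \<in> unit_span"
proof -
  have "e i j * y \<in> unit_span" if "i < n" "j < n" for i j
    using y
  proof (induction rule: unit_span_induct)
    case subspace
    show ?case
      by (rule subspaceI) (auto simp: unit_span_def scale_mult_right distrib_left
          intro: span_zero span_add span_scale)
  next
    case (unit k l)
    then show ?case using that unit_mult[of i j k l] unit_in_unit_span span_zero by (auto simp: unit_span_def)
  qed
  show ?thesis using x
  proof (induction rule: unit_span_induct)
    case subspace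
    show ?case
      by (rule subspaceI) (auto simp: unit_span_def scale_mult_left distrib_right
          intro: span_zero span_add span_scale)
  qed fact
qed

text \<open>
The compression of an element of the matrix subalgebra to one matrix position is a scalar multiple
of the unit there. This is the only way in which matrix entries enter the argument.
\<close>

lemma unit_span_corner:
  assumes x: "x \<in> unit_span" and "i < n" "p < n" "q < n" "j < n"
  obtains c where "e i p * x * e q j = c *s e i j"
proof -
  have "\<exists>c. e i p * x * e q j = c *s e i j" using x
  proof (induction rule: unit_span_induct)
    case subspace
    show ?case
      by (rule subspaceI)
        (auto simp: distrib_left distrib_right scale_mult_left scale_mult_right
          simp flip: scale_left_distrib intro: exI[of _ 0])
  next
    case (unit k l)
    then show ?case using assms
      by (auto simp: unit_mult intro: exI[of _ 0] exI[of _ 1])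
  qed
  then show thesis using that by blast
qed

lemma expand: "x = (\<Sum>i<n. \<Sum>j<n. e i i * x * e j j)"
proof -
  have "x = (\<Sum>i<n. e i i) * x * (\<Sum>j<n. e j j)" by (simp add: unit_sum)
  also have "\<dots> = (\<Sum>i<n. \<Sum>j<n. e i i * x * e j j)"
    by (simp only: sum_distrib_right[of _ _ x] sum_product)
  finally show ?thesis .
qed

lemma unit_span_sums: "finite S \<Longrightarrow> (\<And>s. s \<in> S \<Longrightarrow> g s \<in> unit_span) \<Longrightarrow> sum g S \<in> unit_span"
  unfolding unit_span_def by (rule span_sum)

lemma unit_span_diff: "x \<in> unit_span \<Longrightarrow> y \<in> unit_span \<Longrightarrow> x - y \<in> unit_span"
  unfolding unit_span_def by (rule span_diff)

lemma unit_span_scale: "x \<in> unit_span \<Longrightarrow> c *s x \<in> unit_span"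
  unfolding unit_span_def by (rule span_scale)

lemma scalar_if_units_scalar: "x = (\<Sum>i<n. c *s e i i) \<Longrightarrow> x = c *s 1"
  by (simp add: unit_sum flip: scale_sum_right)

end

section \<open>The rank of an idempotent\<close>

context matrix_units
begin

text \<open>
Under the identification of \<open>unit_span\<close> with a matrix algebra, \<open>x * e 0 0 = x\<close> says that \<open>x\<close> is a matrix
supported in its first column, and \<open>e 0 0 * x = x\<close> that it is supported in its first row. So the
\<open>u s\<close> are column vectors, the \<open>v s\<close> are row vectors, and they are biorthogonal.
\<close>

definition dual_system :: "'s set \<Rightarrow> ('s \<Rightarrow> 'a) \<Rightarrow> ('s \<Rightarrow> 'a) \<Rightarrow> bool" where
  "dual_system S u v \<longleftrightarrow> finite S \<and> (\<forall>s\<in>S. u s \<in> unit_span \<and> v s \<in> unit_span \<and>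
     u s * e 0 0 = u s \<and> e 0 0 * v s = v s \<and> (\<forall>t\<in>S. v s * u t = (if s = t then e 0 0 else 0)))"

lemma dual_systemD:
  assumes "dual_system S u v"
  shows "finite S" "s \<in> S \<Longrightarrow> u s \<in> unit_span" "s \<in> S \<Longrightarrow> v s \<in> unit_span" "s \<in> S \<Longrightarrow> u s * e 0 0 = u s"
    "s \<in> S \<Longrightarrow> e 0 0 * v s = v s" "\<lbrakk>s \<in> S; t \<in> S\<rbrakk> \<Longrightarrow> v s * u t = (if s = t then e 0 0 else 0)"
  using assms by (auto simp: dual_system_def)

lemma dual_system_independent:
  assumes D: "dual_system S u v"
  shows "inj_on u S" "independent (u ` S)"
proof -
  note D = dual_systemD[OF D]
  have nz: "e 0 0 \<noteq> 0" using unit_nonzero size_pos by blast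
  show inj: "inj_on u S"
  proof (rule inj_onI)
    fix s t assume "s \<in> S" "t \<in> S" "u s = u t"
    then have "(if s = t then e 0 0 else 0) = e 0 0"
      using D(6)[of s t] D(6)[of s s] by simp
    then show "s = t" using nz by (auto split: if_splits)
  qed
  show "independent (u ` S)"
  proof (rule independent_if_scalars_zero)
    show "finite (u ` S)" using D by simp
    fix c x assume 0: "(\<Sum>x\<in>u ` S. c x *s x) = 0" and "x \<in> u ` S"
    then obtain t where t: "t \<in> S" "x = u t" by blast
    have "0 = v t * (\<Sum>s\<in>S. c (u s) *s u s)"
      using 0 by (simp add: sum.reindex[OF inj])
    also have "\<dots> = (\<Sum>s\<in>S. if s = t then c (u t) *s e 0 0 else 0)"
      unfolding sum_distrib_left using t D(6) by (intro sum.cong) (auto simp: scale_mult_right)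
    also have "\<dots> = c (u t) *s e 0 0" using t D(1) by simp
    finally show "c x = 0" using t nz by simp
  qed
qed

text \<open>
If \<open>\<Sum>w t * z t = 1\<close>, the columns \<open>w t\<close> span all columns, while the columns \<open>u s\<close> are independent.
Counting vectors rather than taking traces is essential here, because traces only see cardinalities
modulo the characteristic.
\<close>

lemma dual_system_card_le:
  assumes S: "dual_system S u v" and T: "dual_system T w z" and one: "(\<Sum>t\<in>T. w t * z t) = 1"
  shows "card S \<le> card T"
proof -
  note S' = dual_systemD[OF S] and T' = dual_systemD[OF T]
  have "u s \<in> span (w ` T)" if s: "s \<in> S" for s
  proof -
    have "u s = (\<Sum>t\<in>T. w t * (z t * u s))"
      using arg_cong[OF one, of "\<lambda>x. x * u s"] by (simp add: sum_distrib_right mult.assoc)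
    also have "\<dots> \<in> span (w ` T)"
    proof (rule span_sum)
      fix t assume t: "t \<in> T"
      have h: "z t * u s \<in> unit_span" using S'(2)[OF s] T'(3)[OF t] unit_span_mult by blast
      obtain c where "e 0 0 * (z t * u s) * e 0 0 = c *s e 0 0"
        using unit_span_corner[OF h size_pos size_pos size_pos size_pos] .
      then have "z t * u s = c *s e 0 0"
        using S'(4)[OF s] T'(5)[OF t] by (metis mult.assoc)
      then have "w t * (z t * u s) = c *s w t" using T'(4)[OF t] by (simp add: scale_mult_right)
      then show "w t * (z t * u s) \<in> span (w ` T)" using t by (auto intro: span_scale span_base)
    qed
    finally show ?thesis .
  qed
  then have "card (u ` S) \<le> card (w ` T)"
    using independent_span_bound[OF _ dual_system_independent(2)[OF S], of "w ` T"] T'(1) by blast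
  then show ?thesis
    using dual_system_independent(1)[OF S] dual_system_independent(1)[OF T] by (simp add: card_image)
qed

lemma units_dual_system: "dual_system {..<n} (\<lambda>i. e i 0) (\<lambda>i. e 0 i)"
  and units_dual_sum: "(\<Sum>i<n. e i 0 * e 0 i) = 1"
  using size_pos by (auto simp: dual_system_def unit_mult unit_in_unit_span simp flip: unit_sum)

text \<open>
This is the rank factorization of an idempotent matrix: \<open>g = U V\<close> with \<open>V U\<close> an identity matrix of size
\<open>d\<close>, the rank of \<open>g\<close>. A dual system compatible with \<open>g\<close> that has the largest possible size must
exhaust \<open>g\<close>, since a nonzero remainder is again idempotent and yields one more dual pair.
\<close>

lemma idempotent_factorization:
  assumes g: "g \<in> unit_span" "g * g = g"
  obtains d u v where "dual_system {..<d::nat} u v" "(\<Sum>s<d. u s * v s) = g"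
    "\<And>s. s < d \<Longrightarrow> g * u s = u s" "\<And>s. s < d \<Longrightarrow> v s * g = v s"
proof -
  define P where "P d \<longleftrightarrow> (\<exists>u v. dual_system {..<d::nat} u v \<and> (\<forall>s<d. g * u s = u s \<and> v s * g = v s))" for d
  have "P 0" by (simp add: P_def dual_system_def)
  moreover have bound: "\<forall>d. P d \<longrightarrow> d \<le> n"
    using dual_system_card_le[OF _ units_dual_system units_dual_sum] by (fastforce simp: P_def)
  ultimately obtain d where d: "P d" "\<And>d'. P d' \<Longrightarrow> d' \<le> d"
    using Greatest_le_nat[of P _ n] GreatestI_nat[of P 0 n] by blast
  then obtain u v where uv: "dual_system {..<d} u v" "\<And>s. s < d \<Longrightarrow> g * u s = u s"
    "\<And>s. s < d \<Longrightarrow> v s * g = v s" by (auto simp: P_def)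
  note D = dual_systemD[OF uv(1), simplified]
  define r where "r = g - (\<Sum>s<d. u s * v s)"
  have r_unit_span: "r \<in> unit_span" unfolding r_def
    by (intro unit_span_diff g unit_span_sums unit_span_mult D) auto
  have ru: "r * u t = 0" if t: "t < d" for t
  proof -
    have "(\<Sum>s<d. u s * v s) * u t = (\<Sum>s<d. if s = t then u t else 0)"
      unfolding sum_distrib_right using t D by (intro sum.cong) (auto simp: mult.assoc)
    also have "\<dots> = u t" using t by simp
    finally show ?thesis using t uv(2) by (simp add: r_def left_diff_distrib)
  qed
  have vr: "v t * r = 0" if t: "t < d" for t
  proof -
    have "v t * (\<Sum>s<d. u s * v s) = (\<Sum>s<d. if s = t then v t else 0)"
      unfolding sum_distrib_left using t D by (intro sum.cong) (auto simp flip: mult.assoc)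
    also have "\<dots> = v t" using t by simp
    finally show ?thesis using t uv(3) by (simp add: r_def right_diff_distrib)
  qed
  have gr: "g * r = r" using g(2) uv(2)
    by (simp add: r_def right_diff_distrib sum_distrib_left flip: mult.assoc)
  have rg: "r * g = r" using g(2) uv(3)
    by (simp add: r_def left_diff_distrib sum_distrib_right mult.assoc)
  have "r * r = r * g - (\<Sum>s<d. r * u s * v s)"
    by (subst (2) r_def) (simp add: right_diff_distrib sum_distrib_left mult.assoc)
  then have rr: "r * r = r" using ru rg by simp
  have "r = 0"
  proof (rule ccontr)
    assume "r \<noteq> 0"
    then obtain i j where ij: "i < n" "j < n" "e i i * r * e j j \<noteq> 0"
      using expand[of r] by (metis (no_types, lifting) lessThan_iff sum.neutral)
    obtain c where c: "e i i * r * e j j = c *s e i j"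
      using unit_span_corner[OF r_unit_span] ij by metis
    with ij have c0: "c \<noteq> 0" by auto
    \<comment> \<open>If the entry of the remainder at position (i, j) is nonzero,
        its column j and its row i, suitably scaled, form the new pair.\<close>
    let ?u = "r * e j 0" and ?v = "inverse c *s (e 0 i * r)"
    have "e 0 i * r * e j 0 = e 0 i * (e i i * r * e j j) * e j 0"
    proof -
      have "e 0 i = e 0 i * e i i" "e j 0 = e j j * e j 0" using ij size_pos by (simp_all add: unit_mult)
      then show ?thesis by (metis mult.assoc)
    qed
    also have "\<dots> = c *s e 0 0"
      unfolding c using ij size_pos by (simp add: scale_mult_left scale_mult_right unit_mult)
    finally have "e 0 i * r * e j 0 = c *s e 0 0" .
    then have vu: "?v * ?u = e 0 0"
      using c0 rr by (simp add: scale_mult_left mult.assoc flip: mult.assoc[of r r])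
    have "v s * ?u = 0" if "s < d" for s
      using vr[OF that] by (simp flip: mult.assoc)
    moreover have "?v * u s = 0" if "s < d" for s
      using ru[OF that] by (simp add: scale_mult_left mult.assoc)
    moreover have "?u * e 0 0 = ?u" "e 0 0 * ?v = ?v"
      using ij size_pos by (simp_all add: unit_mult unit_mult_assoc mult.assoc scale_mult_right)
    moreover have "?u \<in> unit_span" "?v \<in> unit_span"
      using ij size_pos by (auto intro!: unit_span_mult unit_span_scale r_unit_span unit_in_unit_span)
    ultimately have "dual_system {..<Suc d} (u(d := ?u)) (v(d := ?v))"
      using D vu by (auto simp: dual_system_def less_Suc_eq)
    moreover have "g * ?u = ?u" "?v * g = ?v"
      using gr rg by (simp_all add: scale_mult_left mult.assoc flip: mult.assoc[of g r])
    ultimately have "P (Suc d)" unfolding P_def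
      using uv by (intro exI[of _ "u(d := ?u)"] exI[of _ "v(d := ?v)"]) (auto simp: less_Suc_eq)
    then show False using d(2) by fastforce
  qed
  then show thesis using that[OF uv(1)] uv by (simp add: r_def)
qed

text \<open>
A unital inclusion of \<open>m \<times> m\<close> matrices into \<open>n \<times> n\<close> matrices forces \<open>n = m * d\<close>, where \<open>d\<close> is the rank
in the larger algebra of a diagonal unit of the smaller one. Factoring \<open>E 0 0\<close> by rank and transporting
the factors along the units \<open>E i 0\<close> and \<open>E 0 i\<close> produces a dual system of size \<open>m * d\<close> that resolves
the identity, and so does the system of units \<open>e i 0\<close>, \<open>e 0 i\<close> of size \<open>n\<close>.
\<close>

lemma unit_splits_into_equivalent_units:
  assumes E: "matrix_units scale m E" and sub: "\<And>i j. \<lbrakk>i < m; j < m\<rbrakk> \<Longrightarrow> E i j \<in> unit_span"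
  obtains d u v where "m * d = n" "(\<Sum>s<d. u s * v s) = E 0 0"
    "\<And>s. s < d \<Longrightarrow> v s * u s = e 0 0" "\<And>s. s < d \<Longrightarrow> u s \<in> unit_span" "\<And>s. s < d \<Longrightarrow> v s \<in> unit_span"
proof -
  interpret E: matrix_units scale m E by fact
  have g: "E 0 0 \<in> unit_span" "E 0 0 * E 0 0 = E 0 0" 
    using sub[OF E.size_pos E.size_pos] E.unit_mult[OF E.size_pos E.size_pos E.size_pos E.size_pos]
    by simp_all
  obtain d u v where d: "dual_system {..<d::nat} u v" "(\<Sum>s<d. u s * v s) = E 0 0"
    "\<And>s. s < d \<Longrightarrow> E 0 0 * u s = u s" "\<And>s. s < d \<Longrightarrow> v s * E 0 0 = v s"
    using idempotent_factorization[OF g] by blast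
  note D = dual_systemD[OF d(1), simplified]
  let ?S = "{..<m} \<times> {..<d}" and ?w = "\<lambda>(i, s). E i 0 * u s" and ?z = "\<lambda>(i, s). v s * E 0 i"
  have zw: "v s * (E 0 i * (E j 0 * u t)) = (if i = j \<and> s = t then e 0 0 else 0)"
    if "s < d" "t < d" "i < m" "j < m" for i j s t
  proof -
    have "E 0 i * (E j 0 * u t) = (if i = j then u t else 0)"
      using that E.size_pos d(3) by (simp add: E.unit_mult_assoc)
    then show ?thesis using that D(6) by simp
  qed
  have ev: "e 0 0 * (v s * x) = v s * x" if "s < d" for s x
    using D(5)[OF that] by (simp flip: mult.assoc)
  have wz: "dual_system ?S ?w ?z"
    unfolding dual_system_def
  proof (intro conjI ballI)
    fix p assume p: "p \<in> ?S"
    show "?w p \<in> unit_span" "?z p \<in> unit_span"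
      using p D E.size_pos sub by (auto intro!: unit_span_mult)
    show "?w p * e 0 0 = ?w p" "e 0 0 * ?z p = ?z p" using p D ev by (auto simp: mult.assoc)
    fix q assume "q \<in> ?S"
    then show "?z p * ?w q = (if p = q then e 0 0 else 0)" 
      using p zw by (auto simp: mult.assoc split: if_splits)
  qed simp
  have "(\<Sum>p\<in>?S. ?w p * ?z p) = (\<Sum>i<m. \<Sum>s<d. E i 0 * (u s * v s) * E 0 i)"
    by (simp add: sum.cartesian_product case_prod_unfold mult.assoc)
  also have "\<dots> = (\<Sum>i<m. E i 0 * E 0 0 * E 0 i)"
    by (simp add: d(2) flip: sum_distrib_left sum_distrib_right)
  also have "\<dots> = 1" using E.size_pos by (simp add: E.unit_mult E.unit_sum)
  finally have one: "(\<Sum>p\<in>?S. ?w p * ?z p) = 1" .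
  have "card ?S = n"
    using dual_system_card_le[OF wz units_dual_system units_dual_sum]
      dual_system_card_le[OF units_dual_system wz one] by simp
  then show thesis using that[of d u v] d(2) D by simp
qed

end

section \<open>The trace\<close>

context matrix_units
begin

text \<open>
This is the usual trace times the corner unit \<open>e 0 0\<close>, which makes a coefficient functional
superfluous.
\<close>

definition trace :: "'a \<Rightarrow> 'a" where
  "trace x = (\<Sum>i<n. e 0 i * x * e i 0)"

lemma trace_add: "trace (x + y) = trace x + trace y"
  and trace_diff: "trace (x - y) = trace x - trace y"
  and trace_scale: "trace (c *s x) = c *s trace x"
  and trace_0: "trace 0 = 0"
  by (simp_all add: trace_def distrib_left distrib_right sum.distrib left_diff_distrib
      right_diff_distrib sum_subtractf scale_mult_left scale_mult_right scale_sum_right)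

lemma trace_sum: "trace (sum g S) = (\<Sum>s\<in>S. trace (g s))"
  by (induction S rule: infinite_finite_induct) (auto simp: trace_0 trace_add)

lemma trace_one: "trace 1 = of_nat n *s e 0 0"
proof -
  have "trace 1 = (\<Sum>i<n. (1::'f) *s e 0 0)" 
    unfolding trace_def using size_pos by (intro sum.cong) (auto simp: unit_mult)
  also have "\<dots> = of_nat n *s e 0 0" by (subst scale_sum_left[symmetric]) simp
  finally show ?thesis .
qed

lemma trace_corner_unit: "trace (e 0 0) = e 0 0"
proof -
  have "trace (e 0 0) = (\<Sum>i<n. if i = 0 then e 0 0 else 0)"
    unfolding trace_def using size_pos by (intro sum.cong) (auto simp: unit_mult)
  then show ?thesis using size_pos by simp
qed

lemma trace_mult:
  assumes "x \<in> unit_span" "y \<in> unit_span"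
  shows "trace (x * y) = (\<Sum>i<n. \<Sum>j<n. (e 0 i * x * e j 0) * (e 0 j * y * e i 0))"
proof -
  have "e 0 i * (x * y) * e i 0 = (\<Sum>j<n. (e 0 i * x * e j 0) * (e 0 j * y * e i 0))" if "i < n" for i
  proof -
    have "e 0 i * (x * y) * e i 0 = e 0 i * x * (\<Sum>j<n. e j 0 * e 0 j) * (y * e i 0)"
      by (simp add: units_dual_sum mult.assoc)
    then show ?thesis by (simp add: sum_distrib_left sum_distrib_right mult.assoc)
  qed
  then show ?thesis by (simp add: trace_def)
qed

text \<open>
Expanding both sides over the middle index leaves products of two elements of the corner at
\<open>e 0 0\<close>, which consists of scalar multiples of one idempotent and is therefore commutative.
\<close>

lemma trace_commute:
  assumes x: "x \<in> unit_span" and y: "y \<in> unit_span"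
  shows "trace (x * y) = trace (y * x)"
proof -
  have comm: "(e 0 i * x * e j 0) * (e 0 j * y * e i 0) = (e 0 j * y * e i 0) * (e 0 i * x * e j 0)"
    if ij: "i < n" "j < n" for i j
  proof -
    obtain a where a: "e 0 i * x * e j 0 = a *s e 0 0"
      using unit_span_corner[OF x size_pos ij size_pos] .
    obtain b where b: "e 0 j * y * e i 0 = b *s e 0 0"
      using unit_span_corner[OF y size_pos ij(2,1) size_pos] .
    show ?thesis unfolding a b
      by (simp add: scale_mult_left scale_mult_right mult.commute[of a])
  qed
  have "trace (x * y) = (\<Sum>i<n. \<Sum>j<n. (e 0 j * y * e i 0) * (e 0 i * x * e j 0))"
    unfolding trace_mult[OF x y] using comm by (intro sum.cong) auto
  also have "\<dots> = trace (y * x)"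
    unfolding trace_mult[OF y x] by (rule sum.swap)
  finally show ?thesis .
qed

end

section \<open>Matrix units from matrix subalgebras\<close>

context unital_algebra
begin

lemma matrix_iso_units:
  assumes iso: "matrix_iso n B \<phi>" and one: "1 \<in> B"
  obtains e where "matrix_units scale n e" "B \<subseteq> matrix_units.unit_span scale n e"
proof -
  have bij: "bij_betw \<phi> (carrier_mat n n) B"
    and add: "\<And>M N. \<lbrakk>M \<in> carrier_mat n n; N \<in> carrier_mat n n\<rbrakk> \<Longrightarrow> \<phi> (M + N) = \<phi> M + \<phi> N"
    and mult: "\<And>M N. \<lbrakk>M \<in> carrier_mat n n; N \<in> carrier_mat n n\<rbrakk> \<Longrightarrow> \<phi> (M * N) = \<phi> M * \<phi> N"
    and smult: "\<And>c M. M \<in> carrier_mat n n \<Longrightarrow> \<phi> (c \<cdot>\<^sub>m M) = c *s \<phi> M"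
    using iso unfolding matrix_iso_def by auto
  have zero: "\<phi> (0\<^sub>m n n) = 0" using add[of "0\<^sub>m n n" "0\<^sub>m n n"] by simp
  have sums: "\<phi> (mat n n (\<lambda>p. \<Sum>s\<in>S. G s p)) = (\<Sum>s\<in>S. \<phi> (mat n n (G s)))"
    if "finite S" for S :: "'s set" and G :: "'s \<Rightarrow> nat \<times> nat \<Rightarrow> 'f"
    using that
  proof induction
    case empty
    have "mat n n (\<lambda>p. 0) = (0\<^sub>m n n :: 'f mat)" by (rule eq_matI) auto
    then show ?case using zero by simp
  next
    case (insert s S)
    have "mat n n (\<lambda>p. \<Sum>s\<in>insert s S. G s p) = mat n n (G s) + mat n n (\<lambda>p. \<Sum>s\<in>S. G s p)"
      using insert by (intro eq_matI) auto
    then show ?case using insert add by simp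
  qed
  have unit: "\<phi> (1\<^sub>m n) = 1"
  proof -
    obtain M where M: "M \<in> carrier_mat n n" "\<phi> M = 1"
      using one bij unfolding bij_betw_def by (metis imageE)
    then have "\<phi> (1\<^sub>m n) * 1 = 1" using mult[of "1\<^sub>m n" M] by simp
    then show ?thesis by simp
  qed
  define E :: "nat \<times> nat \<Rightarrow> 'f mat" where "E q = mat n n (\<lambda>p. if p = q then 1 else 0)" for q
  have E_carrier [simp]: "E q \<in> carrier_mat n n" for q by (simp add: E_def)
  have E_mult: "E (i, j) * E (k, l) = (if j = k then E (i, l) else 0\<^sub>m n n)"
    if "i < n" "j < n" "k < n" "l < n" for i j k l
  proof (rule eq_matI)
    fix a b assume "a < dim_row (if j = k then E (i, l) else 0\<^sub>m n n)"
      "b < dim_col (if j = k then E (i, l) else 0\<^sub>m n n)"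
    then have ab: "a < n" "b < n" by (auto simp: E_def split: if_splits)
    have "(E (i, j) * E (k, l)) $$ (a, b) = (\<Sum>t\<in>{0..<n}. E (i, j) $$ (a, t) * E (k, l) $$ (t, b))"
      using ab by (simp add: E_def scalar_prod_def)
    also have "\<dots> = (\<Sum>t\<in>{0..<n}. if t = j then (if a = i \<and> j = k \<and> b = l then 1 else 0) else 0)"
      using ab by (intro sum.cong) (auto simp: E_def)
    also have "\<dots> = (if a = i \<and> j = k \<and> b = l then 1 else 0)"
      using that by (simp add: sum.delta)
    finally show "(E (i, j) * E (k, l)) $$ (a, b) = (if j = k then E (i, l) else 0\<^sub>m n n) $$ (a, b)"
      using ab by (auto simp: E_def)
  qed (auto simp: E_def)
  let ?e = "\<lambda>i j. \<phi> (E (i, j))"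
  have "mat n n (\<lambda>p. \<Sum>i<n. if p = (i, i) then 1 else 0) = (1\<^sub>m n :: 'f mat)"
  proof (rule eq_matI)
    fix a b assume "a < dim_row (1\<^sub>m n :: 'f mat)" "b < dim_col (1\<^sub>m n :: 'f mat)"
    then have ab: "a < n" "b < n" by auto
    have "(\<Sum>i<n. if (a, b) = (i, i) then 1 else 0) = (\<Sum>i<n. if i = a then (if a = b then 1 else 0) else (0::'f))"
      by (intro sum.cong) auto
    then show "mat n n (\<lambda>p. \<Sum>i<n. if p = (i, i) then 1 else 0) $$ (a, b) = (1\<^sub>m n :: 'f mat) $$ (a, b)"
      using ab by (simp add: sum.delta)
  qed auto
  then have "(\<Sum>i<n. ?e i i) = 1"
    using sums[of "{..<n}" "\<lambda>i p. if p = (i, i) then 1 else 0"] unit by (simp add: E_def)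
  then have units: "matrix_units scale n ?e"
    using E_mult zero by unfold_locales (auto simp flip: mult)
  interpret matrix_units scale n ?e by (rule units)
  have "B \<subseteq> unit_span"
  proof
    fix x assume "x \<in> B"
    then obtain M where M: "M \<in> carrier_mat n n" "x = \<phi> M" using bij unfolding bij_betw_def by blast
    let ?Q = "{..<n} \<times> {..<n}"
    have "M = mat n n (\<lambda>p. \<Sum>q\<in>?Q. M $$ q * (if p = q then 1 else 0))"
    proof (rule eq_matI, goal_cases)
      case (1 a b)
      have "(\<Sum>q\<in>?Q. M $$ q * (if (a, b) = q then 1 else 0)) = (\<Sum>q\<in>?Q. if q = (a, b) then M $$ (a, b) else 0)"
        by (intro sum.cong) auto
      also have "\<dots> = M $$ (a, b)" using 1 by simp
      finally show ?case using 1 by simp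
    qed (use M in auto)
    then have "x = (\<Sum>q\<in>?Q. \<phi> (mat n n (\<lambda>p. M $$ q * (if p = q then 1 else 0))))"
      using sums[of ?Q "\<lambda>q p. M $$ q * (if p = q then 1 else 0)"] M(2) by simp
    also have "\<dots> = (\<Sum>q\<in>?Q. M $$ q *s \<phi> (E q))"
    proof (rule sum.cong[OF refl])
      fix q
      have "mat n n (\<lambda>p. M $$ q * (if p = q then 1 else 0)) = M $$ q \<cdot>\<^sub>m E q"
        by (rule eq_matI) (auto simp: E_def)
      then show "\<phi> (mat n n (\<lambda>p. M $$ q * (if p = q then 1 else 0))) = M $$ q *s \<phi> (E q)"
        by (simp add: smult)
    qed
    also have "\<dots> \<in> unit_span"
      by (intro unit_span_sums) (auto intro!: unit_span_scale unit_in_unit_span)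
    finally show "x \<in> unit_span" .
  qed
  with units show thesis using that by blast
qed

lemma matrix_degree_units:
  assumes "n \<in> matrix_degrees"
  obtains e where "matrix_units scale n e"
  using assms matrix_iso_units unfolding matrix_degrees_def matrix_subalgebra_def by blast

lemma locally_matrix_units:
  assumes "locally_matrix" "finite X"
  obtains n e where "n \<in> matrix_degrees" "matrix_units scale n e"
    "X \<subseteq> matrix_units.unit_span scale n e"
proof -
  obtain n B where B: "n > 0" "matrix_subalgebra n B" "insert 1 X \<subseteq> B"
    using assms unfolding locally_matrix_def by (metis finite.insertI)
  then obtain \<phi> where "matrix_iso n B \<phi>" unfolding matrix_subalgebra_def by blast
  then obtain e where "matrix_units scale n e" "B \<subseteq> matrix_units.unit_span scale n e"
    using matrix_iso_units B by blast
  moreover have "n \<in> matrix_degrees" using B unfolding matrix_degrees_def by blast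
  ultimately show thesis using that B by blast
qed

lemma lie_ideal_algebra_iff:
  "lie_ideal lie_of_algebra K \<longleftrightarrow> subspace K \<and> (\<forall>x. \<forall>y\<in>K. x * y - y * x \<in> K)"
  unfolding lie_ideal_def lie_of_algebra_def subspace_def by auto

end

section \<open>Lie ideals and commutators\<close>

context matrix_units
begin

text \<open>
For \<open>e\<close> with \<open>e * e = 0\<close>, the double commutator \<open>[e, [e, b]]\<close> equals \<open>- 2 * e * b * e\<close>. With \<open>e = e j i\<close> this
is \<open>- 2\<close> times the entry of \<open>b\<close> at \<open>(i, j)\<close> times \<open>e j i\<close>. It is here that the characteristic must
differ from 2.
\<close>

lemma opposite_unit_in_lie_ideal:
  assumes two: "(2::'f) \<noteq> 0" and K: "lie_ideal lie_of_algebra K"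
    and b: "b \<in> K" and ij: "i < n" "j < n" "i \<noteq> j"
    and c: "e i i * b * e j j = c *s e i j" "c \<noteq> 0"
  shows "e j i \<in> K"
proof -
  have sub: "subspace K" and brk: "\<And>x y. y \<in> K \<Longrightarrow> x * y - y * x \<in> K"
    using K by (auto simp: lie_ideal_algebra_iff)
  have sq: "e j i * e j i = 0" using ij by (simp add: unit_mult)
  have "e j i * b * e j i = e j i * (e i i * b * e j j) * e j i"
  proof -
    have "e j i * (e i i * b * e j j) * e j i = (e j i * e i i) * b * (e j j * e j i)"
      by (simp only: mult.assoc)
    then show ?thesis using ij by (simp add: unit_mult)
  qed
  also have "\<dots> = c *s e j i"
    unfolding c using ij by (simp add: scale_mult_left scale_mult_right unit_mult)
  finally have ebe: "e j i * b * e j i = c *s e j i" .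
  have "e j i * (e j i * b - b * e j i) - (e j i * b - b * e j i) * e j i
      = (e j i * e j i) * b - (e j i * b * e j i) - (e j i * b * e j i) + b * (e j i * e j i)"
    by (simp add: algebra_simps)
  also have "\<dots> = (- 2 * c) *s e j i"
    unfolding ebe sq by (simp flip: scale_minus_left scale_left_diff_distrib)
  finally have "(- 2 * c) *s e j i \<in> K" using brk b by metis
  then have "inverse (- 2 * c) *s ((- 2 * c) *s e j i) \<in> K" by (rule subspace_scale[OF sub])
  then show ?thesis using two c(2) by simp
qed

text \<open>
A matrix with a nonzero entry off the diagonal is covered by the double commutator above. A diagonal
matrix that is not scalar has two distinct diagonal entries, and its commutator with the matrix unit
joining the two positions is a nonzero multiple of that unit.
\<close>

lemma nonscalar_lie_ideal_contains_unit:
  assumes two: "(2::'f) \<noteq> 0" and K: "lie_ideal lie_of_algebra K"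
    and a: "a \<in> K" "a \<in> unit_span" "a \<notin> scalars"
  obtains i j where "i < n" "j < n" "i \<noteq> j" "e i j \<in> K"
proof (cases "\<exists>i<n. \<exists>j<n. i \<noteq> j \<and> e i i * a * e j j \<noteq> 0")
  case True
  then obtain i j where ij: "i < n" "j < n" "i \<noteq> j" "e i i * a * e j j \<noteq> 0" by blast
  obtain c where c: "e i i * a * e j j = c *s e i j"
    using unit_span_corner[OF a(2)] ij by metis
  with ij have "c \<noteq> 0" by auto
  then show thesis using that opposite_unit_in_lie_ideal[OF two K a(1) ij(1-3) c] ij by blast
next
  case False
  have sub: "subspace K" and brk: "\<And>x y. y \<in> K \<Longrightarrow> x * y - y * x \<in> K"
    using K by (auto simp: lie_ideal_algebra_iff)
  have "\<exists>c. e i i * a * e i i = c *s e i i" if "i < n" for i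
    using unit_span_corner[OF a(2)] that by metis
  then obtain c where c: "\<And>i. i < n \<Longrightarrow> e i i * a * e i i = c i *s e i i" by metis
  have "a = (\<Sum>i<n. \<Sum>j<n. e i i * a * e j j)" by (rule expand)
  also have "\<dots> = (\<Sum>i<n. \<Sum>j<n. if j = i then c i *s e i i else 0)"
    using False c by (intro sum.cong) auto
  also have "\<dots> = (\<Sum>i<n. c i *s e i i)" by simp
  finally have diag: "a = (\<Sum>i<n. c i *s e i i)" .
  have "\<exists>i<n. c i \<noteq> c 0"
  proof (rule ccontr)
    assume const: "\<not> ?thesis"
    have "a = (\<Sum>i<n. c 0 *s e i i)" unfolding diag
    proof (rule sum.cong[OF refl])
      show "c k *s e k k = c 0 *s e k k" if "k \<in> {..<n}" for k
        using const that by (metis lessThan_iff)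
    qed
    then have "a = c 0 *s 1" by (rule scalar_if_units_scalar)
    then show False using a(3) by (simp add: scalars_def)
  qed
  then obtain i where i: "i < n" "c i \<noteq> c 0" by blast
  have left: "a * e i 0 = c i *s e i 0"
  proof -
    have "a * e i 0 = (\<Sum>k<n. if k = i then c i *s e i 0 else 0)"
      unfolding diag sum_distrib_right using i size_pos
      by (intro sum.cong) (auto simp: scale_mult_left unit_mult)
    then show ?thesis using i by simp
  qed
  have right: "e i 0 * a = c 0 *s e i 0"
  proof -
    have "e i 0 * a = (\<Sum>k<n. if k = 0 then c 0 *s e i 0 else 0)"
      unfolding diag sum_distrib_left using i size_pos
      by (intro sum.cong) (auto simp: scale_mult_right unit_mult)
    then show ?thesis using size_pos by simp
  qed
  have "(c 0 - c i) *s e i 0 \<in> K"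
    using brk[OF a(1), of "e i 0"] by (simp add: left right scale_left_diff_distrib)
  then have "inverse (c 0 - c i) *s ((c 0 - c i) *s e i 0) \<in> K" by (rule subspace_scale[OF sub])
  then have "e i 0 \<in> K" using i(2) by simp
  moreover have "i \<noteq> 0" using i(2) by metis
  ultimately show thesis using that i(1) size_pos by blast
qed

text \<open>
From \<open>e i j\<close>, brackets with units on the right reach the rest of row \<open>i\<close>, brackets with units on the
left then reach every position outside column \<open>i\<close>. The units of column \<open>i\<close> are the opposites of those
of row \<open>i\<close>, so the double commutator supplies them.
\<close>

lemma offdiagonal_units_in_lie_ideal:
  assumes two: "(2::'f) \<noteq> 0" and K: "lie_ideal lie_of_algebra K"
    and ij: "i < n" "j < n" "i \<noteq> j" "e i j \<in> K"
    and kl: "k < n" "l < n" "k \<noteq> l"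
  shows "e k l \<in> K"
proof -
  have sub: "subspace K" and brk: "\<And>x y. y \<in> K \<Longrightarrow> x * y - y * x \<in> K"
    using K by (auto simp: lie_ideal_algebra_iff)
  have row: "e i m \<in> K" if "m < n" "m \<noteq> i" for m
  proof (cases "m = j")
    case False
    have "- (e j m * e i j - e i j * e j m) \<in> K" using brk[OF ij(4)] subspace_neg[OF sub] by blast
    then show ?thesis using that ij by (simp add: unit_mult)
  qed (use ij in simp)
  consider "k = i" | "k \<noteq> i" "l \<noteq> i" | "l = i" by blast
  then show ?thesis
  proof cases
    case 1
    then show ?thesis using row kl by blast
  next
    case 2
    then have "e k i * e i l - e i l * e k i \<in> K" using row brk kl by blast
    then show ?thesis using kl ij by (simp add: unit_mult)
  next
    case 3
    then have "e i k \<in> K" using row kl by blast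
    moreover have "e i i * e i k * e k k = 1 *s e i k" using kl ij by (simp add: unit_mult)
    ultimately show ?thesis using opposite_unit_in_lie_ideal[OF two K, of "e i k" i k 1] kl ij 3 by simp
  qed
qed

text \<open>
Once all off-diagonal units lie in \<open>K\<close>, every bracket with one of them does as well. By bilinearity
only brackets of two diagonal units remain, and these vanish.
\<close>

lemma commutators_in_nonscalar_lie_ideal:
  assumes two: "(2::'f) \<noteq> 0" and K: "lie_ideal lie_of_algebra K"
    and a: "a \<in> K" "a \<in> unit_span" "a \<notin> scalars"
    and x: "x \<in> unit_span" and y: "y \<in> unit_span"
  shows "x * y - y * x \<in> K"
proof -
  have sub: "subspace K" and brk: "\<And>x y. y \<in> K \<Longrightarrow> x * y - y * x \<in> K"
    using K by (auto simp: lie_ideal_algebra_iff)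
  have off: "e k l \<in> K" if "k < n" "l < n" "k \<noteq> l" for k l
    using nonscalar_lie_ideal_contains_unit[OF two K a] offdiagonal_units_in_lie_ideal[OF two K] that by metis
  have "x * e k l - e k l * x \<in> K" if kl: "k < n" "l < n" for k l
  proof (cases "k = l")
    case True
    show ?thesis using x
    proof (induction rule: unit_span_induct)
      case subspace
      show ?case
      proof (rule subspaceI, goal_cases)
        case (2 x y)
        then have "(x * e k l - e k l * x) + (y * e k l - e k l * y) \<in> K" using subspace_add[OF sub] by blast
        then show ?case by (simp add: algebra_simps)
      next
        case (3 c x)
        then have "c *s (x * e k l - e k l * x) \<in> K" using subspace_scale[OF sub] by blast
        then show ?case by (simp add: scale_mult_left scale_mult_right scale_right_diff_distrib)
      qed (simp add: subspace_0[OF sub])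
    next
      case (unit i j)
      show ?case
      proof (cases "i = j")
        case True
        then show ?thesis using unit kl \<open>k = l\<close> subspace_0[OF sub] by (simp add: unit_mult)
      next
        case False
        then have "- (e k l * e i j - e i j * e k l) \<in> K" using off brk unit subspace_neg[OF sub] by blast
        then show ?thesis by simp
      qed
    qed
  qed (use off brk kl in blast)
  note units = this
  show ?thesis using y
  proof (induction rule: unit_span_induct)
    case subspace
    show ?case
    proof (rule subspaceI, goal_cases)
      case (2 y z)
      then have "(x * y - y * x) + (x * z - z * x) \<in> K" using subspace_add[OF sub] by blast
      then show ?case by (simp add: algebra_simps)
    next
      case (3 c y)
      then have "c *s (x * y - y * x) \<in> K" using subspace_scale[OF sub] by blast
      then show ?case by (simp add: scale_mult_left scale_mult_right scale_right_diff_distrib)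
    qed (simp add: subspace_0[OF sub])
  qed (fact units)
qed

text \<open>
Off-diagonal units are commutators, and any two diagonal units differ by a commutator.
\<close>

lemma unit_span_subset_if_commutators:
  assumes sub: "subspace K" and comm: "\<And>x y. x * y - y * x \<in> K" and corner: "e 0 0 \<in> K"
  shows "unit_span \<subseteq> K"
proof
  fix x assume "x \<in> unit_span"
  then show "x \<in> K"
  proof (induction rule: unit_span_induct)
    case (unit i j)
    show ?case
    proof (cases "i = j")
      case True
      have "(e i 0 * e 0 i - e 0 i * e i 0) + e 0 0 \<in> K" using comm corner subspace_add[OF sub] by blast
      then show ?thesis using True unit size_pos by (simp add: unit_mult)
    next
      case False
      then show ?thesis using comm[of "e i i" "e i j"] unit by (simp add: unit_mult)
    qed
  qed (use sub in simp)
qed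

text \<open>
Modulo commutators all diagonal units are equal, so \<open>1\<close> is congruent to \<open>n\<close> times the corner unit.
\<close>

lemma corner_unit_if_degree_invertible:
  assumes sub: "subspace K" and comm: "\<And>x y. x * y - y * x \<in> K" and one: "1 \<in> K"
    and n: "(of_nat n :: 'f) \<noteq> 0"
  shows "e 0 0 \<in> K"
proof -
  have "(\<Sum>i<n. e 0 i * e i 0 - e i 0 * e 0 i) + 1 \<in> K"
    by (intro subspace_add[OF sub] subspace_sum[OF sub] comm one)
  also have "(\<Sum>i<n. e 0 i * e i 0 - e i 0 * e 0 i) + 1 = trace 1"
    by (simp add: sum_subtractf units_dual_sum trace_def)
  also have "\<dots> = of_nat n *s e 0 0" by (rule trace_one)
  finally have "inverse (of_nat n) *s (of_nat n *s e 0 0) \<in> K" by (rule subspace_scale[OF sub])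
  then show ?thesis using n by simp
qed

text \<open>
The summands \<open>u s * v s\<close> of \<open>E 0 0\<close> are congruent modulo commutators to \<open>v s * u s = e 0 0\<close>. The same
exchange of factors computes the trace.
\<close>

lemma corner_unit_mod_commutators:
  assumes E: "matrix_units scale m E" and in_span: "\<And>i j. \<lbrakk>i < m; j < m\<rbrakk> \<Longrightarrow> E i j \<in> unit_span"
  obtains d where "m * d = n" "trace (E 0 0) = of_nat d *s e 0 0"
    "E 0 0 - of_nat d *s e 0 0 \<in> span {x * y - y * x |x y. True}"
proof -
  obtain d u v where d: "m * d = n" "(\<Sum>s<d. u s * v s) = E 0 0"
    "\<And>s. s < d \<Longrightarrow> v s * u s = e 0 0" "\<And>s. s < d \<Longrightarrow> u s \<in> unit_span" "\<And>s. s < d \<Longrightarrow> v s \<in> unit_span"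
    using unit_splits_into_equivalent_units[OF E in_span] by blast
  have const: "(\<Sum>s<d. e 0 0) = of_nat d *s e 0 0"
    using scale_sum_left[of "\<lambda>_. 1" "{..<d}" "e 0 0"] by simp
  have "trace (E 0 0) = (\<Sum>s<d. trace (v s * u s))"
    unfolding d(2)[symmetric] trace_sum using d(4,5) by (intro sum.cong trace_commute) auto
  also have "\<dots> = (\<Sum>s<d. e 0 0)" using d(3) trace_corner_unit by (intro sum.cong) auto
  finally have "trace (E 0 0) = of_nat d *s e 0 0" using const by simp
  moreover have "E 0 0 - of_nat d *s e 0 0 \<in> span {x * y - y * x |x y. True}"
  proof -
    have "(\<Sum>s<d. v s * u s) = (\<Sum>s<d. e 0 0)" using d(3) by (intro sum.cong) auto
    then have "(\<Sum>s<d. u s * v s - v s * u s) = E 0 0 - of_nat d *s e 0 0"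
      unfolding sum_subtractf d(2) const by simp
    moreover have "(\<Sum>s<d. u s * v s - v s * u s) \<in> span {x * y - y * x |x y. True}"
      by (intro span_sum span_base) blast
    ultimately show ?thesis by simp
  qed
  ultimately show thesis using that d(1) by blast
qed

end

section \<open>The ideal generated by commutators and scalars\<close>

context unital_algebra
begin

definition scalar_commutator_span :: "'a set" where
  "scalar_commutator_span = span (insert 1 {x * y - y * x |x y. True})"

lemma commutator_in_span: "x * y - y * x \<in> scalar_commutator_span"
  unfolding scalar_commutator_span_def by (intro span_base) auto

lemma lie_ideal_scalar_commutator_span: "lie_ideal lie_of_algebra scalar_commutator_span"
  unfolding lie_ideal_algebra_iff using commutator_in_span by (auto simp: scalar_commutator_span_def)

lemma scalars_subset_scalar_commutator_span: "scalars \<subseteq> scalar_commutator_span"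
  unfolding scalars_def scalar_commutator_span_def by (auto intro: span_scale span_base)

text \<open>
The trace depends on the chosen matrix units and is symmetric only on the subalgebra which they span.
The finite set \<open>X\<close> collects the elements that occur in a presentation of \<open>x\<close> as a combination of
commutators and \<open>1\<close>; for every system of units that spans them, only the multiple \<open>c\<close> of \<open>1\<close>
contributes, and \<open>c\<close> is the same for all these systems.
\<close>

lemma trace_on_scalar_commutator_span:
  assumes "x \<in> scalar_commutator_span"
  obtains X c where "finite X"
    "\<And>n e. \<lbrakk>matrix_units scale n e; X \<subseteq> matrix_units.unit_span scale n e\<rbrakk> \<Longrightarrow>
       matrix_units.trace n e x = (c * of_nat n) *s e 0 0"
proof -
  have "\<exists>X c. finite X \<and> (\<forall>n e. matrix_units scale n e \<longrightarrow> X \<subseteq> matrix_units.unit_span scale n e \<longrightarrow>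
       matrix_units.trace n e x = (c * of_nat n) *s e 0 0)"
    using assms unfolding scalar_commutator_span_def
  proof (induction rule: span_induct_alt)
    case base
    show ?case by (intro exI[of _ "{}"] exI[of _ 0]) (auto simp: matrix_units.trace_0)
  next
    case (step a g y)
    obtain Y c where Y: "finite Y" "\<And>n e. \<lbrakk>matrix_units scale n e; Y \<subseteq> matrix_units.unit_span scale n e\<rbrakk> \<Longrightarrow>
       matrix_units.trace n e y = (c * of_nat n) *s e 0 0" using step by blast
    have lin: "matrix_units.trace n e (a *s g + y) = a *s matrix_units.trace n e g + matrix_units.trace n e y"
      if "matrix_units scale n e" for n e g y
      using that by (simp add: matrix_units.trace_add matrix_units.trace_scale)
    from step(1) consider "g = 1" | p q where "g = p * q - q * p" by blast
    then show ?case
    proof cases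
      case 1
      then show ?thesis using Y
        by (intro exI[of _ Y] exI[of _ "a + c"])
          (auto simp: lin matrix_units.trace_one distrib_right scale_left_distrib)
    next
      case (2 p q)
      then show ?thesis using Y
        by (intro exI[of _ "insert p (insert q Y)"] exI[of _ c])
          (auto simp: lin matrix_units.trace_diff matrix_units.trace_commute)
    qed
  qed
  then show thesis using that by blast
qed

lemma simple_mod_scalars_iff:
  "simple_lie_algebra (lie_quotient lie_of_algebra scalars) \<longleftrightarrow>
     (\<exists>x y. x * y - y * x \<notin> scalars) \<and>
     (\<forall>K. lie_ideal lie_of_algebra K \<and> scalars \<subseteq> K \<longrightarrow> K = scalars \<or> K = UNIV)"
proof -
  interpret lie_algebra lie_of_algebra by (rule lie_algebra_lie_of_algebra)
  interpret lie_algebra_ideal lie_of_algebra scalars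
    by unfold_locales (rule lie_ideal_scalars)
  show ?thesis unfolding simple_quotient_iff by (simp add: lie_of_algebra_def)
qed

end

section \<open>Corner units and the exponent of the characteristic\<close>

context unital_algebra
begin

lemma nu_steinitz_number:
  assumes "prime p"
  shows "nu p steinitz_number = (SUP n\<in>matrix_degrees. enat (multiplicity p n))"
  using assms by (simp add: steinitz_number_def nu_lcm nu_of_nat image_image)

text \<open>
A degree \<open>m\<close> with a larger power of \<open>p\<close> than \<open>n\<close> exists, and the two matrix algebras lie in a common
one of degree \<open>k = n * d\<close>. As \<open>m\<close> divides \<open>k\<close>, the prime \<open>p\<close> divides \<open>d\<close>, so that \<open>E 0 0\<close>, which is
congruent to \<open>d\<close> times a corner unit, is a sum of commutators.
\<close>

lemma corner_unit_if_prime_power_divides_degrees: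
  assumes lm: "locally_matrix" and char: "CHAR('f) = p" and p: "prime p"
    and inf: "nu p steinitz_number = \<infinity>"
    and sub: "subspace K" and comm: "\<And>x y. x * y - y * x \<in> K"
    and n: "0 < n" and E: "matrix_units scale n E"
  shows "E 0 0 \<in> K"
proof -
  have "enat (multiplicity p n) < (SUP m\<in>matrix_degrees. enat (multiplicity p m))"
    using inf nu_steinitz_number[OF p] by simp
  then obtain m where m: "m \<in> matrix_degrees" "multiplicity p n < multiplicity p m"
    by (auto simp: less_SUP_iff)
  obtain G where G: "matrix_units scale m G" using matrix_degree_units[OF m(1)] .
  let ?X = "case_prod E ` ({..<n} \<times> {..<n}) \<union> case_prod G ` ({..<m} \<times> {..<m})"
  have fin: "finite ?X" by simp
  obtain k f where f: "k \<in> matrix_degrees" "matrix_units scale k f"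
    "?X \<subseteq> matrix_units.unit_span scale k f"
    using locally_matrix_units[OF lm fin] .
  interpret f: matrix_units scale k f by fact
  have E_in: "E i j \<in> f.unit_span" if "i < n" "j < n" for i j
    using that by (intro subsetD[OF f(3)] UnI1 image_eqI[of _ _ "(i, j)"]) auto
  obtain d where d: "n * d = k" "f.trace (E 0 0) = of_nat d *s f 0 0"
    "E 0 0 - of_nat d *s f 0 0 \<in> span {x * y - y * x |x y. True}"
    using f.corner_unit_mod_commutators[OF E E_in] .
  have G_in: "G i j \<in> f.unit_span" if "i < m" "j < m" for i j
    using that by (intro subsetD[OF f(3)] UnI2 image_eqI[of _ _ "(i, j)"]) auto
  obtain d' where "m * d' = k" using f.corner_unit_mod_commutators[OF G G_in] .
  then have "m dvd n * d" using d by (metis dvd_triv_left)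
  then have "multiplicity p m \<le> multiplicity p (n * d)"
    using d f.size_pos by (intro dvd_imp_multiplicity_le) auto
  also have "\<dots> = multiplicity p n + multiplicity p d"
    using d f.size_pos p by (intro prime_elem_multiplicity_mult_distrib) auto
  finally have "0 < multiplicity p d" using m by simp
  then have "p dvd d" by (metis not_dvd_imp_multiplicity_0 less_irrefl)
  then have "(of_nat d :: 'f) = 0" using char by (simp add: of_nat_eq_0_iff_char_dvd)
  moreover have "span {x * y - y * x |x y. True} \<subseteq> K" using comm by (intro span_minimal sub) auto
  ultimately show ?thesis using d(3) by auto
qed

text \<open>
In a matrix algebra of degree \<open>k = n * d\<close> that contains all elements involved, the trace of an element
of the span of commutators and scalars is a multiple of \<open>k\<close>, hence zero. The trace of \<open>E 0 0\<close> is given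
by \<open>d\<close>, and \<open>p\<close> cannot divide \<open>d\<close> because \<open>k\<close> contains no larger power of \<open>p\<close> than \<open>n\<close>.
\<close>

lemma corner_unit_not_in_scalar_commutator_span:
  assumes lm: "locally_matrix" and char: "CHAR('f) = p" and p: "prime p"
    and n: "p dvd n" "0 < n" and max: "\<And>m. m \<in> matrix_degrees \<Longrightarrow> multiplicity p m \<le> multiplicity p n"
    and E: "matrix_units scale n E"
  shows "E 0 0 \<notin> scalar_commutator_span"
proof
  assume "E 0 0 \<in> scalar_commutator_span"
  then obtain X c where X: "finite X"
    "\<And>n e. \<lbrakk>matrix_units scale n e; X \<subseteq> matrix_units.unit_span scale n e\<rbrakk> \<Longrightarrow>
       matrix_units.trace n e (E 0 0) = (c * of_nat n) *s e 0 0"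
    using trace_on_scalar_commutator_span by blast
  have fin: "finite (X \<union> case_prod E ` ({..<n} \<times> {..<n}))" using X(1) by simp
  obtain k f where f: "k \<in> matrix_degrees" "matrix_units scale k f"
    "X \<union> case_prod E ` ({..<n} \<times> {..<n}) \<subseteq> matrix_units.unit_span scale k f"
    using locally_matrix_units[OF lm fin] .
  interpret f: matrix_units scale k f by fact
  have E_in: "E i j \<in> f.unit_span" if "i < n" "j < n" for i j
    using that by (intro subsetD[OF f(3)] UnI2 image_eqI[of _ _ "(i, j)"]) auto
  obtain d where d: "n * d = k" "f.trace (E 0 0) = of_nat d *s f 0 0"
    "E 0 0 - of_nat d *s f 0 0 \<in> span {x * y - y * x |x y. True}"
    using f.corner_unit_mod_commutators[OF E E_in] .
  have "(of_nat k :: 'f) = 0"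
    using d(1) n char by (auto simp: of_nat_eq_0_iff_char_dvd)
  then have "f.trace (E 0 0) = 0" using X(2)[OF f(2)] f(3) by simp
  then have "(of_nat d :: 'f) = 0" using d(2) f.unit_nonzero f.size_pos by simp
  then have "p dvd d" using char by (simp add: of_nat_eq_0_iff_char_dvd)
  then have "0 < multiplicity p d"
    using d f.size_pos p by (subst multiplicity_gt_zero_iff) auto
  moreover have "multiplicity p k = multiplicity p n + multiplicity p d"
    unfolding d(1)[symmetric]
    using d f.size_pos p by (intro prime_elem_multiplicity_mult_distrib) auto
  ultimately show False using max[OF f(1)] by simp
qed

lemma offdiagonal_unit_nonscalar:
  assumes "matrix_units scale n e" and ij: "i < n" "j < n" "i \<noteq> j"
  shows "e i j \<notin> scalars"
proof
  interpret matrix_units scale n e by fact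
  assume "e i j \<in> scalars"
  then obtain c where c: "e i j = c *s 1" by (auto simp: scalars_def)
  have "e i i * e i j * e i i = c *s e i i"
    using ij by (simp add: c scale_mult_left scale_mult_right unit_mult)
  moreover have "e i i * e i j * e i i = 0" using ij by (simp add: unit_mult)
  ultimately have "c = 0" using unit_nonzero ij by simp
  then show False using c unit_nonzero ij by simp
qed

lemma nonscalar_exists:
  assumes "infinite_dimensional"
  obtains a where "a \<notin> scalars"
proof -
  have "independent {1}" by (simp add: dependent_single)
  then have "span {1} \<noteq> UNIV"
    using assms vector_space_axioms unfolding infinite_dimensional_def
      finite_dimensional_vector_space_def finite_dimensional_vector_space_axioms_def by blast
  then show thesis using that unfolding span_singleton scalars_def by blast
qed

end

section \<open>Simplicity modulo scalars\<close>

theorem theorem1: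
  fixes scale :: "'f::field \<Rightarrow> 'a::ring_1 \<Rightarrow> 'a"
  assumes "unital_algebra scale"
    and "CHAR('f) \<noteq> 2"
    and "assoc_algebra.locally_matrix scale"
    and "assoc_algebra.infinite_dimensional scale"
  shows "simple_lie_algebra
           (lie_quotient (assoc_algebra.lie_of_algebra scale) (unital_algebra.scalars scale)) \<longleftrightarrow>
         CHAR('f) = 0 \<or>
         (CHAR('f) > 0 \<and> nu CHAR('f) (unital_algebra.steinitz_number scale) \<in> {0, \<infinity>})"
proof -
  interpret unital_algebra scale by fact
  let ?p = "CHAR('f)"
  note lm = assms(3) and inf_dim = assms(4)
  have two: "(2::'f) \<noteq> 0"
  proof
    assume "(2::'f) = 0"
    then have "?p dvd 2" using of_nat_eq_0_iff_char_dvd[where 'a = 'f, of 2] by simp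
    then show False using assms(2) CHAR_not_1 by (metis prime_nat_iff two_is_prime_nat One_nat_def)
  qed
  have prime: "prime ?p" if "?p > 0" using that by (rule prime_CHAR_semidom)
  have commutator_in_ideal: "x * y - y * x \<in> K"
    if K: "lie_ideal lie_of_algebra K" and a: "a \<in> K" "a \<notin> scalars" for K a x y
  proof -
    have "finite {a, x, y}" by simp
    then obtain n e where e: "matrix_units scale n e" "{a, x, y} \<subseteq> matrix_units.unit_span scale n e"
      using locally_matrix_units[OF lm] by metis
    then show ?thesis using matrix_units.commutators_in_nonscalar_lie_ideal[OF e(1) two K a(1) _ a(2)] by simp
  qed
  have nonabelian: "\<exists>x y. x * y - y * x \<notin> scalars"
  proof -
    obtain a where a: "a \<notin> scalars" using nonscalar_exists[OF inf_dim] .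
    obtain n e where e: "matrix_units scale n e" "{a} \<subseteq> matrix_units.unit_span scale n e"
      using locally_matrix_units[OF lm finite.insertI[OF finite.emptyI]] by blast
    interpret matrix_units scale n e by fact
    \<comment> \<open>Applied to the improper ideal, this only says that the degree is at least 2.\<close>
    obtain i j where ij: "i < n" "j < n" "i \<noteq> j"
      using nonscalar_lie_ideal_contains_unit[OF two _ _ _ a, of UNIV] e(2)
      by (auto simp: lie_ideal_algebra_iff)
    have "e i i * e i j - e i j * e i i = e i j" using ij by (simp add: unit_mult)
    then show ?thesis using offdiagonal_unit_nonscalar[OF e(1) ij] by metis
  qed
  show ?thesis
  proof
    assume simple: "simple_lie_algebra (lie_quotient lie_of_algebra scalars)"
    show "?p = 0 \<or> (?p > 0 \<and> nu ?p steinitz_number \<in> {0, \<infinity>})"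
    proof (rule ccontr)
      assume neg: "\<not> ?thesis"
      then have p: "?p > 0" "prime ?p" using prime by auto
      obtain v where v: "nu ?p steinitz_number = enat v" "v > 0"
        using neg by (cases "nu ?p steinitz_number") (auto simp: zero_enat_def)
      then have sup: "(SUP n\<in>matrix_degrees. enat (multiplicity ?p n)) = enat v"
        using nu_steinitz_number[OF p(2)] by simp
      then have "enat (v - 1) < (SUP n\<in>matrix_degrees. enat (multiplicity ?p n))" using v by simp
      \<comment> \<open>A finite supremum of exponents is attained.\<close>
      then obtain n where n: "n \<in> matrix_degrees" "v \<le> multiplicity ?p n"
        by (auto simp: less_SUP_iff)
      have max: "multiplicity ?p m \<le> multiplicity ?p n" if "m \<in> matrix_degrees" for m
      proof -
        have "enat (multiplicity ?p m) \<le> enat v" unfolding sup[symmetric] using that by (rule SUP_upper)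
        then show ?thesis using n by simp
      qed
      have n_pos: "0 < n" using n(1) by (simp add: matrix_degrees_def)
      have dvd: "?p dvd n" using n v by (metis not_dvd_imp_multiplicity_0 not_le)
      obtain E where E: "matrix_units scale n E" using matrix_degree_units[OF n(1)] .
      have "E 0 0 \<notin> scalar_commutator_span"
        using corner_unit_not_in_scalar_commutator_span[OF lm refl p(2) dvd n_pos max E] .
      moreover obtain x y where "x * y - y * x \<notin> scalars" using nonabelian by blast
      ultimately have "scalar_commutator_span \<noteq> UNIV" "scalar_commutator_span \<noteq> scalars"
        using commutator_in_span by auto
      then show False
        using simple lie_ideal_scalar_commutator_span scalars_subset_scalar_commutator_span
        unfolding simple_mod_scalars_iff by blast
    qed
  next
    assume cond: "?p = 0 \<or> (?p > 0 \<and> nu ?p steinitz_number \<in> {0, \<infinity>})"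
    have "K = UNIV" if K: "lie_ideal lie_of_algebra K" "scalars \<subseteq> K" "K \<noteq> scalars" for K
    proof -
      obtain a where "a \<in> K" "a \<notin> scalars" using K by blast
      then have comm: "\<And>x y. x * y - y * x \<in> K" using commutator_in_ideal K(1) by blast
      have sub: "subspace K" using K(1) by (simp add: lie_ideal_algebra_iff)
      have one: "1 \<in> K" using K(2) unfolding scalars_def by (metis rangeI scale_one subsetD)
      have "x \<in> K" for x
      proof -
        obtain n e where e: "n \<in> matrix_degrees" "matrix_units scale n e" "{x} \<subseteq> matrix_units.unit_span scale n e"
          using locally_matrix_units[OF lm finite.insertI[OF finite.emptyI]] by blast
        interpret matrix_units scale n e by fact
        have "e 0 0 \<in> K"
        proof (cases "(of_nat n :: 'f) = 0")
          case False
          then show ?thesis using corner_unit_if_degree_invertible[OF sub comm one] by blast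
        next
          case True
          then have dvd: "?p dvd n" by (simp add: of_nat_eq_0_iff_char_dvd)
          then have p: "?p > 0" using size_pos by (cases "?p = 0") auto
          have "0 < multiplicity ?p n"
            using dvd size_pos prime[OF p] by (subst multiplicity_gt_zero_iff) auto
          also have "enat (multiplicity ?p n) \<le> nu ?p steinitz_number"
            unfolding nu_steinitz_number[OF prime[OF p]] using e(1) by (rule SUP_upper)
          finally have "nu ?p steinitz_number = \<infinity>" using cond p by (auto simp: zero_enat_def)
          then show ?thesis
            using corner_unit_if_prime_power_divides_degrees[OF lm refl prime[OF p] _ sub comm size_pos e(2)] by blast
        qed
        then show ?thesis using unit_span_subset_if_commutators[OF sub comm] e(3) by blast
      qed
      then show ?thesis by blast
    qed
    then show "simple_lie_algebra (lie_quotient lie_of_algebra scalars)"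
      unfolding simple_mod_scalars_iff using nonabelian by blast
  qed
qed

end
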